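(* Let $T>0$ be a fixed horizon, $\rho_T>0$, and suppose the nominal distribution $\mathbb{P}_T^\circ$ of the disturbance vector $\boldsymbol{\xi}_T$ is Gaussian. Let $\Pi_T$ be the class of (possibly nonlinear) causal estimators $\pi_T=(\pi_0,\dots,\pi_{T-1})$, where $\widehat{s}_t=\pi_t(y_t,y_{t-1},\dots,y_0)$, and write $\mathbf{e}_T(\boldsymbol{\xi}_T,\pi_T)=\widehat{\mathbf{s}}_T-\mathbf{s}_T$. Then $$\inf_{\pi_T\in\Pi_T}\ \sup_{\mathbb{P}_T\in\mathcal{W}_T(\mathbb{P}_T^\circ,\rho_T)}\mathbb{E}_{\mathbb{P}_T}\big[\|\mathbf{e}_T(\boldsymbol{\xi}_T,\pi_T)\|^2\big]=\sup_{\mathbb{P}_T\in\mathcal{W}_T(\mathbb{P}_T^\circ,\rho_T)}\ \inf_{\pi_T\in\Pi_T}\mathbb{E}_{\mathbb{P}_T}\big[\|\mathbf{e}_T(\boldsymbol{\xi}_T,\pi_T)\|^2\big].$$ Moreover, this problem admits a saddle point $(\pi_T^\star,\mathbb{P}_T^\star)$ such that $\mathbb{P}_T^\star$ is Gaussian and $\pi_T^\star$ is linear, i.e. $\widehat{\mathbf{s}}_T=\mathcal{K}_T^\star\mathbf{y}_T$ for some block lower-triangular matrix $\mathcal{K}_T^\star\in\mathbb{R}^{Td_s\times Td_y}$.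
   Context: State-space model: $x_{t+1}=Ax_t+Bw_t$, $y_t=C_yx_t+v_t$, $s_t=C_sx_t$, with $x_t\in\mathbb{R}^{d_x}$, $w_t\in\mathbb{R}^{d_w}$, $v_t\in\mathbb{R}^{d_v}$ ($d_v=d_y$), $y_t\in\mathbb{R}^{d_y}$, $s_t\in\mathbb{R}^{d_s}$; $(A,C_y)$ and $(A,C_s)$ detectable and $(A,B)$ controllable. For horizon $T$: $\mathbf{y}_T=[y_0;\dots;y_{T-1}]$, $\mathbf{s}_T=[s_0;\dots;s_{T-1}]$, $\mathbf{w}_T=[x_0;w_0;\dots;w_{T-2}]$ (the unknown initial state is part of the process noise), $\mathbf{v}_T=[v_0;\dots;v_{T-1}]$, and $\boldsymbol{\xi}_T=[\mathbf{w}_T;\mathbf{v}_T]\in\Xi_T=\mathbb{R}^{d_x+(T-1)d_w+Td_v}$. Then $\mathbf{y}_T=\mathcal{H}_T\mathbf{w}_T+\mathbf{v}_T$, $\mathbf{s}_T=\mathcal{L}_T\mathbf{w}_T$ with block lower-triangular $\mathcal{H}_T,\mathcal{L}_T$ determined by the model (the $t$-th block of $\mathcal{H}_T\mathbf{w}_T$ is $C_yA^tx_0+\sum_{\tau=0}^{t-1}C_yA^{t-1-\tau}Bw_\tau$, and similarly for $\mathcal{L}_T$ with $C_s$). The disturbance distributions are zero-mean (standing assumption). The Wasserstein-2 distance between distributions on $\mathbb{R}^n$ with finite second moments is $\mathsf{W}_2(\mathbb{P}_1,\mathbb{P}_2)=(\inf\mathbb{E}\|\mathbf{w}_1-\mathbf{w}_2\|^2)^{1/2}$,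 the infimum over couplings with marginals $\mathbb{P}_1,\mathbb{P}_2$. The ambiguity set is $\mathcal{W}_T(\mathbb{P}_T^\circ,\rho_T)=\{\mathbb{P}_T\text{ on }\Xi_T\text{ with finite second moment}:\mathsf{W}_2(\mathbb{P}_T,\mathbb{P}_T^\circ)\le\rho_T\}$, and $\boldsymbol{\xi}_T\sim\mathbb{P}_T$ in the expectations. *)

theory Defs
  imports "HOL-Probability.Probability"
begin

text \<open>Vectors in R^n are functions nat => real (only indices < n matter);
 matrices are functions nat => nat => real (only indices within the stated
 dimensions matter). Random vectors on R^n live on the product measurable
 space PiM {..<n} (\<lambda>_. borel).\<close>

definition mvec :: "nat \<Rightarrow> (nat \<Rightarrow> nat \<Rightarrow> real) \<Rightarrow> (nat \<Rightarrow> real) \<Rightarrow> nat \<Rightarrow> real" where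
  "mvec d M x = (\<lambda>i. \<Sum>k<d. M i k * x k)"

primrec mpowv :: "nat \<Rightarrow> (nat \<Rightarrow> nat \<Rightarrow> real) \<Rightarrow> nat \<Rightarrow> (nat \<Rightarrow> real) \<Rightarrow> nat \<Rightarrow> real" where
  "mpowv d A 0 x = x"
| "mpowv d A (Suc t) x = mvec d A (mpowv d A t x)"

definition detectable :: "nat \<Rightarrow> nat \<Rightarrow> (nat \<Rightarrow> nat \<Rightarrow> real) \<Rightarrow> (nat \<Rightarrow> nat \<Rightarrow> real) \<Rightarrow> bool" where
  "detectable dx p A C \<longleftrightarrow>
     (\<forall>x. (\<forall>t. \<forall>i<p. mvec dx C (mpowv dx A t x) i = 0) \<longrightarrow>
          (\<forall>i<dx. (\<lambda>t. mpowv dx A t x i) \<longlonglongrightarrow> 0))"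

text \<open>(A,B) controllable (A is dx x dx, B is dx x dw): every state is reachable
 from 0 in dx steps.\<close>
definition controllable :: "nat \<Rightarrow> nat \<Rightarrow> (nat \<Rightarrow> nat \<Rightarrow> real) \<Rightarrow> (nat \<Rightarrow> nat \<Rightarrow> real) \<Rightarrow> bool" where
  "controllable dx dw A B \<longleftrightarrow>
     (\<forall>x. \<exists>u :: nat \<Rightarrow> nat \<Rightarrow> real.
        \<forall>i<dx. x i = (\<Sum>k<dx. mpowv dx A (dx - 1 - k) (mvec dw B (u k)) i))"

definition Rn :: "nat \<Rightarrow> (nat \<Rightarrow> real) measure" where
  "Rn n = PiM {..<n} (\<lambda>_. borel)"

text \<open>Gaussian distribution on R^n with mean m and covariance L L^T
 (possibly degenerate): law of m + L z, z standard normal.\<close>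
definition gaussian_with_mean :: "nat \<Rightarrow> (nat \<Rightarrow> real) \<Rightarrow> (nat \<Rightarrow> real) measure \<Rightarrow> bool" where
  "gaussian_with_mean n m P \<longleftrightarrow>
     (\<exists>L :: nat \<Rightarrow> nat \<Rightarrow> real.
        P = distr (PiM {..<n} (\<lambda>_. density lborel std_normal_density)) (Rn n)
                  (\<lambda>z. \<lambda>i\<in>{..<n}. m i + (\<Sum>j<n. L i j * z j)))"

definition gaussian :: "nat \<Rightarrow> (nat \<Rightarrow> real) measure \<Rightarrow> bool" where
  "gaussian n P \<longleftrightarrow> (\<exists>m. gaussian_with_mean n m P)"

definition sqnorm :: "nat \<Rightarrow> (nat \<Rightarrow> real) \<Rightarrow> real" where
  "sqnorm n x = (\<Sum>i<n. (x i)\<^sup>2)"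

definition prob_on :: "nat \<Rightarrow> (nat \<Rightarrow> real) measure \<Rightarrow> bool" where
  "prob_on n P \<longleftrightarrow> prob_space P \<and> sets P = sets (Rn n)"

definition finite_second_moment :: "nat \<Rightarrow> (nat \<Rightarrow> real) measure \<Rightarrow> bool" where
  "finite_second_moment n P \<longleftrightarrow> (\<integral>\<^sup>+ x. ennreal (sqnorm n x) \<partial>P) < \<infinity>"

definition couplings :: "nat \<Rightarrow> (nat \<Rightarrow> real) measure \<Rightarrow> (nat \<Rightarrow> real) measure
     \<Rightarrow> ((nat \<Rightarrow> real) \<times> (nat \<Rightarrow> real)) measure set" where
  "couplings n P1 P2 = {\<mu>. prob_space \<mu> \<and> sets \<mu> = sets (Rn n \<Otimes>\<^sub>M Rn n)
      \<and> distr \<mu> (Rn n) fst = P1 \<and> distr \<mu> (Rn n) snd = P2}"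

definition W2_sq :: "nat \<Rightarrow> (nat \<Rightarrow> real) measure \<Rightarrow> (nat \<Rightarrow> real) measure \<Rightarrow> ennreal" where
  "W2_sq n P1 P2 = (INF \<mu> \<in> couplings n P1 P2.
       \<integral>\<^sup>+ xy. ennreal (sqnorm n (\<lambda>i. fst xy i - snd xy i)) \<partial>\<mu>)"

definition wball :: "nat \<Rightarrow> (nat \<Rightarrow> real) measure \<Rightarrow> real \<Rightarrow> (nat \<Rightarrow> real) measure set" where
  "wball n P0 \<rho> = {P. prob_on n P \<and> finite_second_moment n P \<and> W2_sq n P P0 \<le> ennreal (\<rho>\<^sup>2)}"

text \<open>Model quantities as functions of xi = [x0; w_0..w_{T-2}; v_0..v_{T-1}].\<close>
definition xi_dim :: "nat \<Rightarrow> nat \<Rightarrow> nat \<Rightarrow> nat \<Rightarrow> nat" where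
  "xi_dim dx dw dy T = dx + (T - 1) * dw + T * dy"

primrec state :: "nat \<Rightarrow> nat \<Rightarrow> (nat \<Rightarrow> nat \<Rightarrow> real) \<Rightarrow> (nat \<Rightarrow> nat \<Rightarrow> real)
     \<Rightarrow> (nat \<Rightarrow> real) \<Rightarrow> nat \<Rightarrow> nat \<Rightarrow> real" where
  "state dx dw A B \<xi> 0 = (\<lambda>i. \<xi> i)"
| "state dx dw A B \<xi> (Suc t) =
     (\<lambda>i. mvec dx A (state dx dw A B \<xi> t) i + mvec dw B (\<lambda>k. \<xi> (dx + t * dw + k)) i)"

definition ystack :: "nat \<Rightarrow> nat \<Rightarrow> nat \<Rightarrow> nat \<Rightarrow> (nat \<Rightarrow> nat \<Rightarrow> real) \<Rightarrow> (nat \<Rightarrow> nat \<Rightarrow> real)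
     \<Rightarrow> (nat \<Rightarrow> nat \<Rightarrow> real) \<Rightarrow> (nat \<Rightarrow> real) \<Rightarrow> nat \<Rightarrow> real" where
  "ystack dx dw dy T A B Cy \<xi> j =
     (let t = j div dy; i = j mod dy in
        mvec dx Cy (state dx dw A B \<xi> t) i + \<xi> (dx + (T - 1) * dw + t * dy + i))"

definition signal :: "nat \<Rightarrow> nat \<Rightarrow> (nat \<Rightarrow> nat \<Rightarrow> real) \<Rightarrow> (nat \<Rightarrow> nat \<Rightarrow> real)
     \<Rightarrow> (nat \<Rightarrow> nat \<Rightarrow> real) \<Rightarrow> (nat \<Rightarrow> real) \<Rightarrow> nat \<Rightarrow> nat \<Rightarrow> real" where
  "signal dx dw A B Cs \<xi> t = mvec dx Cs (state dx dw A B \<xi> t)"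

text \<open>Causal estimators: pi t maps (y_0,...,y_t) (a vector in R^{(t+1)dy})
 Borel-measurably to an estimate in R^{ds}.\<close>
definition causal_estimators :: "nat \<Rightarrow> nat \<Rightarrow> nat \<Rightarrow> (nat \<Rightarrow> (nat \<Rightarrow> real) \<Rightarrow> nat \<Rightarrow> real) set" where
  "causal_estimators dy ds T = {\<pi>. \<forall>t<T. \<forall>k<ds.
      (\<lambda>z. \<pi> t z k) \<in> borel_measurable (Rn (Suc t * dy))}"

definition sq_error :: "nat \<Rightarrow> nat \<Rightarrow> nat \<Rightarrow> nat \<Rightarrow> nat \<Rightarrow> (nat \<Rightarrow> nat \<Rightarrow> real) \<Rightarrow> (nat \<Rightarrow> nat \<Rightarrow> real)
     \<Rightarrow> (nat \<Rightarrow> nat \<Rightarrow> real) \<Rightarrow> (nat \<Rightarrow> nat \<Rightarrow> real)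
     \<Rightarrow> (nat \<Rightarrow> (nat \<Rightarrow> real) \<Rightarrow> nat \<Rightarrow> real) \<Rightarrow> (nat \<Rightarrow> real) \<Rightarrow> real" where
  "sq_error dx dw dy ds T A B Cy Cs \<pi> \<xi> =
     (\<Sum>t<T. \<Sum>k<ds.
        (\<pi> t (restrict (ystack dx dw dy T A B Cy \<xi>) {..<Suc t * dy}) k
          - signal dx dw A B Cs \<xi> t k)\<^sup>2)"

definition mse :: "nat \<Rightarrow> nat \<Rightarrow> nat \<Rightarrow> nat \<Rightarrow> nat \<Rightarrow> (nat \<Rightarrow> nat \<Rightarrow> real) \<Rightarrow> (nat \<Rightarrow> nat \<Rightarrow> real)
     \<Rightarrow> (nat \<Rightarrow> nat \<Rightarrow> real) \<Rightarrow> (nat \<Rightarrow> nat \<Rightarrow> real)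
     \<Rightarrow> (nat \<Rightarrow> (nat \<Rightarrow> real) \<Rightarrow> nat \<Rightarrow> real) \<Rightarrow> (nat \<Rightarrow> real) measure \<Rightarrow> ennreal" where
  "mse dx dw dy ds T A B Cy Cs \<pi> P =
     (\<integral>\<^sup>+ \<xi>. ennreal (sq_error dx dw dy ds T A B Cy Cs \<pi> \<xi>) \<partial>P)"

definition block_lower_tri :: "nat \<Rightarrow> nat \<Rightarrow> nat \<Rightarrow> (nat \<Rightarrow> nat \<Rightarrow> real) \<Rightarrow> bool" where
  "block_lower_tri ds dy T K \<longleftrightarrow>
     (\<forall>t<T. \<forall>\<tau><T. \<forall>k<ds. \<forall>l<dy. t < \<tau> \<longrightarrow> K (t * ds + k) (\<tau> * dy + l) = 0)"

definition linear_estimator :: "nat \<Rightarrow> nat \<Rightarrow> nat \<Rightarrow> (nat \<Rightarrow> (nat \<Rightarrow> real) \<Rightarrow> nat \<Rightarrow> real) \<Rightarrow> bool" where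
  "linear_estimator dy ds T \<pi> \<longleftrightarrow>
     (\<exists>K. block_lower_tri ds dy T K \<and>
        (\<forall>t<T. \<forall>k<ds. \<forall>z. \<pi> t z k = (\<Sum>j<Suc t * dy. K (t * ds + k) j * z j)))"

end

theory Submission
  imports Defs
begin

text \<open>Write the nominal law as that of \<open>G0 z\<close> with \<open>z\<close> standard normal on \<open>2 N\<close> coordinates and \<open>G0\<close>
  vanishing on the last \<open>N\<close> columns. All laws of \<open>G z\<close> with \<open>|G - G0| \<le> \<rho>\<close> (Frobenius norm) lie in the Wasserstein ball, and their
  covariances form a compact convex set on which the error of a linear estimator \<open>K\<close> is affine, while it
  is a coercive quadratic in \<open>K\<close>. This finite-dimensional game has a saddle point \<open>(K, G)\<close>.

  Against an arbitrary law of the ball, \<open>G\<close> remains the worst case for \<open>K\<close>: maximising \<open>|E G|\<^sup>2\<close> over a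
  Frobenius ball is a trust region problem, whose multiplier gives a Lagrangian bound that holds
  pointwise, hence for every coupling. Conversely, stationarity in \<open>K\<close> makes the error of row \<open>t\<close>
  orthogonal to \<open>y_0, \<dots>, y_t\<close>; by rotation invariance of \<open>z\<close> the sign of that error can then be flipped
  without changing the joint law with the observations, so no measurable estimator improves on \<open>K\<close>.\<close>

section \<open>Rotation invariance of the standard normal law\<close>

text \<open>The nominal covariance may be singular, so densities and inverse covariances of the
  nominal law are not at hand, and \<open>|E G|^2\<close> is convex in \<open>G\<close>, the wrong
  curvature for a maximisation. The doubled number of columns restores convexity:
  \<open>|G - G0|^2\<close> is affine in the pair formed by \<open>S = G G^T\<close> and the block
  \<open>G1\<close> of the first \<open>N\<close> columns, and a pair \<open>(S, G1)\<close> is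
  realised as soon as \<open>S - G1 G1^T\<close> is positive semidefinite, a convex condition,
  because the last \<open>N\<close> columns can factor this remainder. These columns carry noise
  independent of the nominal vector; spread evenly, it makes one covariance of the set positive
  definite, whence the coercivity. Plane rotations of \<open>z\<close> replace the calculus of
  covariances and independence: they bring factors to triangular form, which yields square factors,
  second moments and the sign flip alike. The flip argument needs no conditional expectation and no
  finiteness of the competing risk. Laws in the ball need not be centred; this does no harm, as the
  upper bound concerns second moments and not variances.\<close>

lemma std_normal_density_mult_cong:
  assumes "p\<^sup>2 + q\<^sup>2 = u\<^sup>2 + v\<^sup>2"
  shows "std_normal_density p * std_normal_density q = std_normal_density u * std_normal_density v"
proof -
  have "std_normal_density p * std_normal_density q = 1 / (2 * pi) * exp (- (p\<^sup>2 + q\<^sup>2) / 2)" for p q :: real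
    by (simp add: std_normal_density_def add_divide_distrib diff_divide_distrib
        flip: exp_add)
  then show ?thesis
    using assms by metis
qed

abbreviation std_normal :: "real measure" where
  "std_normal \<equiv> density lborel std_normal_density"

lemma nn_integral_std_normal_pair:
  fixes f :: "real \<times> real \<Rightarrow> ennreal"
  assumes [measurable]: "f \<in> borel_measurable borel"
  shows "(\<integral>\<^sup>+t. \<integral>\<^sup>+s. f (s, t) \<partial>std_normal \<partial>std_normal)
    = (\<integral>\<^sup>+t. \<integral>\<^sup>+s. ennreal (std_normal_density s * std_normal_density t) * f (s, t) \<partial>lborel \<partial>lborel)"
proof -
  have [measurable]: "f \<in> borel_measurable (borel \<Otimes>\<^sub>M borel)"
    by (simp add: borel_prod)
  show ?thesis
    by (simp add: nn_integral_density nn_integral_cmult [symmetric] ennreal_mult' mult_ac)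
qed

text \<open>Two affine substitutions on the line replace a planar change of variables:
  \<open>u = c * s - d * t\<close> with \<open>t\<close> fixed, which requires
  \<open>c \<noteq> 0\<close>, and after exchanging the integrals \<open>v = (d * u + t) / c\<close>
  with \<open>u\<close> fixed. The factors \<open>1 / |c|\<close> and \<open>|c|\<close> cancel, and
  the product of densities depends on the radius only.\<close>

lemma std_normal_rotation_aux:
  fixes f :: "real \<times> real \<Rightarrow> ennreal" and c d :: real
  assumes [measurable]: "f \<in> borel_measurable borel" and c: "c \<noteq> 0" and cd: "c\<^sup>2 + d\<^sup>2 = 1"
  shows "(\<integral>\<^sup>+t. \<integral>\<^sup>+s. f (c * s - d * t, d * s + c * t) \<partial>std_normal \<partial>std_normal)
    = (\<integral>\<^sup>+t. \<integral>\<^sup>+s. f (s, t) \<partial>std_normal \<partial>std_normal)"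
proof -
  let ?p = "std_normal_density"
  have [measurable]: "f \<in> borel_measurable (borel \<Otimes>\<^sub>M borel)"
    by (simp add: borel_prod)
  have [measurable]: "(\<lambda>x. f (c * fst x - d * snd x, d * fst x + c * snd x)) \<in> borel_measurable borel"
    unfolding borel_prod [symmetric] by measurable
  have dd: "d * d = 1 - c * c"
    using cd by (simp add: power2_eq_square)
  have ddx: "d * (d * x) = x - c * (c * x)" for x
    by (simp add: dd left_diff_distrib flip: mult.assoc)
  have "(\<integral>\<^sup>+t. \<integral>\<^sup>+s. f (c * s - d * t, d * s + c * t) \<partial>std_normal \<partial>std_normal)
    = (\<integral>\<^sup>+t. \<integral>\<^sup>+s. ennreal (?p s * ?p t) * f (c * s - d * t, d * s + c * t) \<partial>lborel \<partial>lborel)"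
    using nn_integral_std_normal_pair [of "\<lambda>x. f (c * fst x - d * snd x, d * fst x + c * snd x)"]
    by simp
  also have "\<dots> = (\<integral>\<^sup>+t. ennreal \<bar>1/c\<bar> * (\<integral>\<^sup>+u. ennreal (?p (d*t/c + 1/c*u) * ?p t)
      * f (u, (d*u+t)/c) \<partial>lborel) \<partial>lborel)"
  proof (rule nn_integral_cong)
    fix t
    have *: "c * (d*t/c + 1/c*u) - d*t = u" "d * (d*t/c + 1/c*u) + c*t = (d*u+t)/c" for u
      using c by (simp_all add: field_simps ddx)
    have "(\<integral>\<^sup>+s. ennreal (?p s * ?p t) * f (c * s - d * t, d * s + c * t) \<partial>lborel)
     = ennreal \<bar>1/c\<bar> * (\<integral>\<^sup>+u. ennreal (?p (d*t/c + 1/c*u) * ?p t)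
         * f (c * (d*t/c + 1/c*u) - d*t, d * (d*t/c + 1/c*u) + c*t) \<partial>lborel)"
      by (rule nn_integral_real_affine) (use c in \<open>auto\<close>)
    then show "(\<integral>\<^sup>+s. ennreal (?p s * ?p t) * f (c * s - d * t, d * s + c * t) \<partial>lborel)
     = ennreal \<bar>1/c\<bar> * (\<integral>\<^sup>+u. ennreal (?p (d*t/c + 1/c*u) * ?p t) * f (u, (d*u+t)/c) \<partial>lborel)"
      unfolding * .
  qed
  also have "\<dots> = (\<integral>\<^sup>+t. \<integral>\<^sup>+u. ennreal \<bar>1/c\<bar> * (ennreal (?p (d*t/c + 1/c*u) * ?p t)
      * f (u, (d*u+t)/c)) \<partial>lborel \<partial>lborel)"
    by (subst nn_integral_cmult) auto
  also have "\<dots> = (\<integral>\<^sup>+u. \<integral>\<^sup>+t. ennreal \<bar>1/c\<bar> * (ennreal (?p (d*t/c + 1/c*u) * ?p t)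
      * f (u, (d*u+t)/c)) \<partial>lborel \<partial>lborel)"
    by (rule lborel_pair.Fubini') measurable
  also have "\<dots> = (\<integral>\<^sup>+u. \<integral>\<^sup>+v. ennreal (?p u * ?p v) * f (u, v) \<partial>lborel \<partial>lborel)"
  proof (rule nn_integral_cong)
    fix u
    have a: "(d*u+(-d*u + c * v))/c = v" for v using c by simp
    have b: "d*(-d*u+c * v)/c + 1/c*u = c*u + d * v" for v
      using c by (simp add: field_simps ddx)
    have e: "?p (c*u+d * v) * ?p (-d*u+c * v) = ?p u * ?p v" for v
    proof (rule std_normal_density_mult_cong)
      have "(c * u + d * v)\<^sup>2 + (- d * u + c * v)\<^sup>2 = (c\<^sup>2 + d\<^sup>2) * (u\<^sup>2 + v\<^sup>2)"
        by (simp add: power2_eq_square algebra_simps)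
      then show "(c * u + d * v)\<^sup>2 + (- d * u + c * v)\<^sup>2 = u\<^sup>2 + v\<^sup>2"
        by (simp add: cd)
    qed
    have "(\<integral>\<^sup>+t. ennreal \<bar>1/c\<bar> * (ennreal (?p (d*t/c + 1/c*u) * ?p t) * f (u, (d*u+t)/c)) \<partial>lborel)
      = ennreal \<bar>c\<bar> * (\<integral>\<^sup>+v. ennreal \<bar>1/c\<bar> * (ennreal (?p (d*(-d*u+c * v)/c + 1/c*u) * ?p (-d*u+c * v))
          * f (u, (d*u+(-d*u+c * v))/c)) \<partial>lborel)"
      by (rule nn_integral_real_affine) (use c in \<open>auto\<close>)
    also have "\<dots> = ennreal \<bar>c\<bar> * (\<integral>\<^sup>+v. ennreal \<bar>1/c\<bar> * (ennreal (?p u * ?p v) * f (u, v)) \<partial>lborel)"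
      unfolding a b e ..
    also have "\<dots> = ennreal \<bar>c\<bar> * ennreal \<bar>1/c\<bar> * (\<integral>\<^sup>+v. ennreal (?p u * ?p v) * f (u, v) \<partial>lborel)"
      by (simp add: nn_integral_cmult mult.assoc)
    also have "ennreal \<bar>c\<bar> * ennreal \<bar>1/c\<bar> = 1"
      using c by (simp flip: ennreal_mult)
    finally show "(\<integral>\<^sup>+t. ennreal \<bar>1/c\<bar> * (ennreal (?p (d*t/c + 1/c*u) * ?p t) * f (u, (d*u+t)/c)) \<partial>lborel)
      = (\<integral>\<^sup>+v. ennreal (?p u * ?p v) * f (u, v) \<partial>lborel)" by simp
  qed
  also have "\<dots> = (\<integral>\<^sup>+v. \<integral>\<^sup>+u. ennreal (?p u * ?p v) * f (u, v) \<partial>lborel \<partial>lborel)"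
    by (rule lborel_pair.Fubini') measurable
  also have "\<dots> = (\<integral>\<^sup>+t. \<integral>\<^sup>+s. f (s, t) \<partial>std_normal \<partial>std_normal)"
    by (simp add: nn_integral_std_normal_pair)
  finally show ?thesis .
qed

lemma std_normal_rotation:
  fixes f :: "real \<times> real \<Rightarrow> ennreal" and c d :: real
  assumes f[measurable]: "f \<in> borel_measurable borel" and cd: "c\<^sup>2 + d\<^sup>2 = 1"
  shows "(\<integral>\<^sup>+t. \<integral>\<^sup>+s. f (c * s - d * t, d * s + c * t) \<partial>std_normal \<partial>std_normal)
    = (\<integral>\<^sup>+t. \<integral>\<^sup>+s. f (s, t) \<partial>std_normal \<partial>std_normal)"
proof (cases "c = 0")
  case False
  then show ?thesis using std_normal_rotation_aux [OF f _ cd] by simp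
next
  case True
  \<comment> \<open>A quarter turn is the square of a turn by an eighth, to which the case \<open>c \<noteq> 0\<close> applies.\<close>
  have [measurable]: "f \<in> borel_measurable (borel \<Otimes>\<^sub>M borel)"
    by (simp add: borel_prod)
  define h where "h = 1 / sqrt 2"
  define k where "k = d / sqrt 2"
  have hk: "h\<^sup>2 + k\<^sup>2 = 1" "h \<noteq> 0" "h * h = k * k" "2 * (h * k) = d"
    using cd True by (auto simp: h_def k_def power2_eq_square)
  define F where "F x = f (h * fst x - k * snd x, k * fst x + h * snd x)" for x
  have F: "F \<in> borel_measurable borel"
    unfolding F_def borel_prod [symmetric] by measurable
  have "f (c * s - d * t, d * s + c * t) = F (h * s - k * t, k * s + h * t)" for s t
  proof -
    have "h * (h * s - k * t) - k * (k * s + h * t) = (h*h - k*k) * s - 2 * (h*k) * t"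
      "k * (h * s - k * t) + h * (k * s + h * t) = (h*h - k*k) * t + 2 * (h*k) * s"
      by (simp_all add: algebra_simps)
    then show ?thesis
      using hk True by (simp add: F_def)
  qed
  then show ?thesis
    using std_normal_rotation_aux [OF F hk(2,1)] std_normal_rotation_aux [OF f hk(2,1)]
    by (simp add: F_def)
qed

lemma prob_space_std_normal: "prob_space std_normal"
  by (rule prob_space_normal_density) simp

text \<open>Indexed by a set and not by a dimension, so that Fubini can split off any single
  coordinate.\<close>

definition std_normal_vec :: "nat set \<Rightarrow> (nat \<Rightarrow> real) measure" where
  "std_normal_vec I = PiM I (\<lambda>_. std_normal)"

lemma prob_space_std_normal_vec: "prob_space (std_normal_vec I)"
  unfolding std_normal_vec_def by (intro prob_space_PiM prob_space_std_normal)

lemma sets_std_normal_vec [measurable_cong]: "sets (std_normal_vec I) = sets (PiM I (\<lambda>_. borel))"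
  unfolding std_normal_vec_def by (intro sets_PiM_cong) auto

lemma space_std_normal_vec: "space (std_normal_vec I) = extensional I"
  by (simp add: std_normal_vec_def space_PiM PiE_def)

lemma nn_integral_std_normal_vec_insert:
  assumes "finite I" "i \<notin> I" and [measurable]: "f \<in> borel_measurable (PiM (insert i I) (\<lambda>_. borel))"
  shows "(\<integral>\<^sup>+z. f z \<partial>std_normal_vec (insert i I))
    = (\<integral>\<^sup>+z. \<integral>\<^sup>+s. f (z(i := s)) \<partial>std_normal \<partial>std_normal_vec I)"
proof -
  interpret product_sigma_finite "\<lambda>_::nat. std_normal"
    by (simp add: product_sigma_finite_def prob_space_std_normal prob_space_imp_sigma_finite)
  have "f \<in> borel_measurable (std_normal_vec (insert i I))"
    by measurable
  then show ?thesis
    unfolding std_normal_vec_def by (rule product_nn_integral_insert [OF assms(1,2)])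
qed

text \<open>Fubini makes \<open>p\<close> and \<open>q\<close> the innermost coordinates; with all
  others frozen, only the planar rotation is left.\<close>

lemma nn_integral_std_normal_vec_rotation:
  fixes f :: "(nat \<Rightarrow> real) \<Rightarrow> ennreal"
  assumes fin: "finite I" and pq: "p \<in> I" "q \<in> I" "p \<noteq> q" and cd: "c\<^sup>2 + d\<^sup>2 = 1"
    and [measurable]: "f \<in> borel_measurable (PiM I (\<lambda>_. borel))"
  shows "(\<integral>\<^sup>+z. f (z(p := c * z p - d * z q, q := d * z p + c * z q)) \<partial>std_normal_vec I)
    = (\<integral>\<^sup>+z. f z \<partial>std_normal_vec I)"
proof -
  define K where "K = I - {p, q}"
  have K: "finite K" "finite (insert q K)" "q \<notin> K" "p \<notin> insert q K" "I = insert p (insert q K)"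
    using fin pq by (auto simp: K_def)
  have split2: "(\<integral>\<^sup>+z. g z \<partial>std_normal_vec I)
      = (\<integral>\<^sup>+x. \<integral>\<^sup>+t. \<integral>\<^sup>+s. g (x(q := t, p := s)) \<partial>std_normal \<partial>std_normal \<partial>std_normal_vec K)"
    if [measurable]: "g \<in> borel_measurable (PiM I (\<lambda>_. borel))" for g :: "_ \<Rightarrow> ennreal"
  proof -
    have *[measurable]: "g \<in> borel_measurable (PiM (insert p (insert q K)) (\<lambda>_. borel))"
      using that K by simp
    interpret sigma_finite_measure std_normal
      by (simp add: prob_space_std_normal prob_space_imp_sigma_finite)
    have "(\<lambda>x. \<integral>\<^sup>+s. g (x(p := s)) \<partial>std_normal) \<in> borel_measurable (PiM (insert q K) (\<lambda>_. borel))"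
      by measurable
    then show ?thesis
      unfolding K(5)
      by (simp only: nn_integral_std_normal_vec_insert [OF K(2,4) *] nn_integral_std_normal_vec_insert [OF K(1,3)])
  qed
  have "(\<lambda>z. z(p := c * z p - d * z q, q := d * z p + c * z q))
      \<in> measurable (PiM I (\<lambda>_. borel)) (PiM I (\<lambda>_. borel))"
    by (rule measurable_fun_upd [where J = I, OF _ measurable_fun_upd [where J = I]])
      (use pq in auto)
  then have meas: "(\<lambda>z. f (z(p := c * z p - d * z q, q := d * z p + c * z q)))
      \<in> borel_measurable (PiM I (\<lambda>_. borel))"
    by (rule measurable_compose) fact
  have tw: "(x(q := t, p := s)) (p := a, q := b) = x(q := b, p := a)" for x :: "nat \<Rightarrow> real" and s t a b
    using pq by auto
  have "(\<integral>\<^sup>+z. f (z(p := c * z p - d * z q, q := d * z p + c * z q)) \<partial>std_normal_vec I)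
     = (\<integral>\<^sup>+x. \<integral>\<^sup>+t. \<integral>\<^sup>+s. f (x(q := d * s + c * t, p := c * s - d * t)) \<partial>std_normal \<partial>std_normal \<partial>std_normal_vec K)"
    unfolding split2 [OF meas] tw using pq by simp
  also have "\<dots> = (\<integral>\<^sup>+x. \<integral>\<^sup>+t. \<integral>\<^sup>+s. f (x(q := t, p := s)) \<partial>std_normal \<partial>std_normal \<partial>std_normal_vec K)"
  proof (rule nn_integral_cong)
    fix x assume "x \<in> space (std_normal_vec K)"
    then have x: "x \<in> space (PiM K (\<lambda>_. borel))"
      by (simp add: space_std_normal_vec space_PiM PiE_def)
    have "(\<lambda>w::real \<times> real. x(q := snd w, p := fst w)) \<in> measurable (borel \<Otimes>\<^sub>M borel) (PiM I (\<lambda>_. borel))"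
      by (rule measurable_fun_upd [where J = "insert q K", OF _ measurable_fun_upd [where J = K]])
        (use K x in auto)
    then have "(\<lambda>w. f (x(q := snd w, p := fst w))) \<in> borel_measurable borel"
      unfolding borel_prod [symmetric] by measurable
    from std_normal_rotation [OF this cd]
    show "(\<integral>\<^sup>+t. \<integral>\<^sup>+s. f (x(q := d * s + c * t, p := c * s - d * t)) \<partial>std_normal \<partial>std_normal)
       = (\<integral>\<^sup>+t. \<integral>\<^sup>+s. f (x(q := t, p := s)) \<partial>std_normal \<partial>std_normal)"
      by simp
  qed
  also have "\<dots> = (\<integral>\<^sup>+z. f z \<partial>std_normal_vec I)"
    by (rule split2 [symmetric]) fact
  finally show ?thesis .
qed

section \<open>Linear images of the standard normal law\<close>

text \<open>The centred Gaussian law with covariance \<open>G G^T\<close>. Rectangular factors are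
  allowed because surplus columns model noise independent of the nominal vector.\<close>

definition gauss_law :: "nat \<Rightarrow> nat \<Rightarrow> (nat \<Rightarrow> nat \<Rightarrow> real) \<Rightarrow> (nat \<Rightarrow> real) measure" where
  "gauss_law n m G = distr (std_normal_vec {..<m}) (Rn n) (\<lambda>z. \<lambda>i\<in>{..<n}. \<Sum>j<m. G i j * z j)"

lemma measurable_lin [measurable]:
  "(\<lambda>z. \<lambda>i\<in>{..<n}. \<Sum>j<m. G i j * z j) \<in> measurable (std_normal_vec {..<m}) (Rn n)"
  unfolding Rn_def by measurable

lemma nn_integral_gauss_law:
  assumes [measurable]: "f \<in> borel_measurable (Rn n)"
  shows "(\<integral>\<^sup>+x. f x \<partial>gauss_law n m G) =
    (\<integral>\<^sup>+z. f (\<lambda>i\<in>{..<n}. \<Sum>j<m. G i j * z j) \<partial>std_normal_vec {..<m})"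
  unfolding gauss_law_def by (rule nn_integral_distr) auto

lemma sets_gauss_law [measurable_cong]: "sets (gauss_law n m G) = sets (Rn n)"
  by (simp add: gauss_law_def)

lemma prob_space_gauss_law: "prob_space (gauss_law n m G)"
  unfolding gauss_law_def by (intro prob_space.prob_space_distr prob_space_std_normal_vec) simp

lemma gauss_law_cong:
  assumes "\<And>i j. i < n \<Longrightarrow> j < m \<Longrightarrow> G i j = G' i j"
  shows "gauss_law n m G = gauss_law n m G'"
  unfolding gauss_law_def using assms by (intro distr_cong) (auto simp: fun_eq_iff)

section \<open>Triangular reduction by Givens rotations\<close>

definition givens :: "real \<Rightarrow> real \<Rightarrow> nat \<Rightarrow> nat \<Rightarrow> (nat \<Rightarrow> nat \<Rightarrow> real) \<Rightarrow> nat \<Rightarrow> nat \<Rightarrow> real" where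
  "givens c d p q G i = (G i)(p := c * G i p + d * G i q, q := c * G i q - d * G i p)"

text \<open>Stands for \<open>G' = G Q\<close> with \<open>Q\<close> orthogonal, but records only
  the two consequences in use: equal laws and equal Gram matrices of the rows.\<close>

definition orth_equiv :: "nat \<Rightarrow> nat \<Rightarrow> (nat \<Rightarrow> nat \<Rightarrow> real) \<Rightarrow> (nat \<Rightarrow> nat \<Rightarrow> real) \<Rightarrow> bool" where
  "orth_equiv n m G G' \<longleftrightarrow> gauss_law n m G = gauss_law n m G' \<and>
    (\<forall>i i'. (\<Sum>j<m. G i j * G i' j) = (\<Sum>j<m. G' i j * G' i' j))"

lemma orth_equiv_refl: "orth_equiv n m G G"
  by (simp add: orth_equiv_def)

lemma orth_equiv_trans: "orth_equiv n m G G' \<Longrightarrow> orth_equiv n m G' G'' \<Longrightarrow> orth_equiv n m G G''"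
  by (simp add: orth_equiv_def)

lemma sum_split2:
  fixes f :: "nat \<Rightarrow> real"
  assumes "p < m" "q < m" "p \<noteq> q"
  shows "(\<Sum>j<m. f j) = f p + f q + (\<Sum>j\<in>{..<m} - {p, q}. f j)"
proof -
  have "(\<Sum>j<m. f j) = f p + (\<Sum>j\<in>{..<m} - {p}. f j)"
    using assms by (subst sum.remove [of _ p]) auto
  also have "(\<Sum>j\<in>{..<m} - {p}. f j) = f q + (\<Sum>j\<in>{..<m} - {p} - {q}. f j)"
    using assms by (subst sum.remove [of _ q]) auto
  finally show ?thesis
    by (simp add: Diff_insert2 [symmetric] insert_commute)
qed

text \<open>\<open>givens\<close> multiplies \<open>G\<close> on the right by a plane rotation. The
  rotation can be moved onto \<open>z\<close>, where it preserves the standard normal law.\<close>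

lemma orth_equiv_givens:
  assumes pq: "p < m" "q < m" "p \<noteq> q" and cd: "c\<^sup>2 + d\<^sup>2 = 1"
  shows "orth_equiv n m G (givens c d p q G)"
proof -
  define r where "r z = z(p := c * z p - d * z q, q := d * z p + c * z q)" for z :: "nat \<Rightarrow> real"
  have r [measurable]: "r \<in> measurable (std_normal_vec {..<m}) (std_normal_vec {..<m})"
    unfolding r_def measurable_cong_sets [OF sets_std_normal_vec sets_std_normal_vec]
    by (rule measurable_fun_upd [where J = "{..<m}", OF _ measurable_fun_upd [where J = "{..<m}"]])
      (use pq in auto)
  have inv: "distr (std_normal_vec {..<m}) (std_normal_vec {..<m}) r = std_normal_vec {..<m}"
  proof (rule measure_eqI)
    fix A assume "A \<in> sets (distr (std_normal_vec {..<m}) (std_normal_vec {..<m}) r)"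
    then have A: "A \<in> sets (std_normal_vec {..<m})" by simp
    then have m: "(\<lambda>x. indicator A x :: ennreal) \<in> borel_measurable (PiM {..<m} (\<lambda>_. borel))"
      by (auto simp: sets_std_normal_vec)
    have "emeasure (distr (std_normal_vec {..<m}) (std_normal_vec {..<m}) r) A
      = (\<integral>\<^sup>+z. indicator A (r z) \<partial>std_normal_vec {..<m})"
      using A by (simp add: nn_integral_distr flip: nn_integral_indicator)
    also have "\<dots> = (\<integral>\<^sup>+z. indicator A z \<partial>std_normal_vec {..<m})"
      unfolding r_def by (rule nn_integral_std_normal_vec_rotation [OF _ _ _ _ cd m]) (use pq in auto)
    finally show "emeasure (distr (std_normal_vec {..<m}) (std_normal_vec {..<m}) r) A
      = emeasure (std_normal_vec {..<m}) A" using A by simp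
  qed simp
  have lin: "(\<Sum>j<m. G i j * r z j) = (\<Sum>j<m. givens c d p q G i j * z j)" for i z
  proof -
    have "(\<Sum>j\<in>{..<m} - {p, q}. G i j * r z j) = (\<Sum>j\<in>{..<m} - {p, q}. givens c d p q G i j * z j)"
      by (rule sum.cong) (auto simp: givens_def r_def)
    then show ?thesis
      using pq by (simp add: sum_split2 [OF pq]) (simp add: givens_def r_def algebra_simps)
  qed
  have "gauss_law n m G = distr (distr (std_normal_vec {..<m}) (std_normal_vec {..<m}) r) (Rn n)
     (\<lambda>z. \<lambda>i\<in>{..<n}. \<Sum>j<m. G i j * z j)"
    unfolding inv gauss_law_def ..
  also have "\<dots> = gauss_law n m (givens c d p q G)"
    unfolding gauss_law_def by (subst distr_distr) (auto simp: comp_def lin)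
  finally have law: "gauss_law n m G = gauss_law n m (givens c d p q G)" .
  have "(\<Sum>j<m. G i j * G i' j) = (\<Sum>j<m. givens c d p q G i j * givens c d p q G i' j)" for i i'
  proof -
    have "(c * a + d * b) * (c * a' + d * b') + (c * b - d * a) * (c * b' - d * a')
      = (c\<^sup>2 + d\<^sup>2) * (a * a' + b * b')" for a b a' b'
      by (simp add: power2_eq_square algebra_simps)
    moreover have "(\<Sum>j\<in>{..<m} - {p, q}. G i j * G i' j)
      = (\<Sum>j\<in>{..<m} - {p, q}. givens c d p q G i j * givens c d p q G i' j)"
      by (rule sum.cong) (auto simp: givens_def)
    ultimately show ?thesis
      using pq by (simp add: sum_split2 [OF pq]) (simp add: givens_def cd)
  qed
  with law show ?thesis
    by (simp add: orth_equiv_def)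
qed

text \<open>Columns are rotated one at a time against the pivot column \<open>i\<close>: the angle
  with cosine \<open>F i i / r\<close> and sine \<open>F i l / r\<close> sends the pair of entries
  to \<open>(r, 0)\<close>. Rows above \<open>i\<close> keep their zeros since both columns involved
  already vanish there.\<close>

lemma orth_equiv_clear_row:
  assumes lower: "\<And>i' k. i' < i \<Longrightarrow> i' < k \<Longrightarrow> k < m \<Longrightarrow> G i' k = 0"
  shows "\<exists>G'. orth_equiv n m G G' \<and> (\<forall>i' k. i' < i \<longrightarrow> i' < k \<longrightarrow> k < m \<longrightarrow> G' i' k = 0)
    \<and> (\<forall>k. i < k \<longrightarrow> k < l \<longrightarrow> k < m \<longrightarrow> G' i k = 0)"
proof (induction l)
  case 0
  show ?case using lower by (intro exI [of _ G] conjI orth_equiv_refl) auto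
next
  case (Suc l)
  then obtain F where F: "orth_equiv n m G F"
    and F1: "\<And>i' k. i' < i \<Longrightarrow> i' < k \<Longrightarrow> k < m \<Longrightarrow> F i' k = 0"
    and F2: "\<And>k. i < k \<Longrightarrow> k < l \<Longrightarrow> k < m \<Longrightarrow> F i k = 0"
    by blast
  show ?case
  proof (cases "i < l \<and> l < m \<and> F i l \<noteq> 0")
    case False
    then have "F i k = 0" if "i < k" "k < Suc l" "k < m" for k
      using F2 [of k] that by (cases "k = l") auto
    then show ?thesis using F F1 by blast
  next
    case True
    define r where "r = sqrt ((F i i)\<^sup>2 + (F i l)\<^sup>2)"
    have "(F i i)\<^sup>2 + (F i l)\<^sup>2 > 0"
      using True by (simp add: add_nonneg_pos)
    then have r: "r > 0" "r\<^sup>2 = (F i i)\<^sup>2 + (F i l)\<^sup>2"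
      by (auto simp: r_def)
    define F' where "F' = givens (F i i / r) (F i l / r) i l F"
    have "orth_equiv n m F F'"
      unfolding F'_def
      by (rule orth_equiv_givens)
        (use True r in \<open>auto simp: power_divide simp flip: add_divide_distrib\<close>)
    then have "orth_equiv n m G F'"
      using F orth_equiv_trans by blast
    moreover have "F' i' k = 0" if "i' < i" "i' < k" "k < m" for i' k
      using that F1 [OF that] F1 [of i' i] F1 [of i' l] True by (auto simp: F'_def givens_def)
    moreover have "F' i k = 0" if "i < k" "k < Suc l" "k < m" for k
      using that F2 [of k] True by (cases "k = l") (auto simp: F'_def givens_def)
    ultimately show ?thesis by blast
  qed
qed

lemma orth_equiv_lower_triangular:
  obtains G' where "orth_equiv n m G G'" "\<And>i k. i < k \<Longrightarrow> k < m \<Longrightarrow> i < l \<Longrightarrow> G' i k = 0"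
proof -
  have "\<exists>G'. orth_equiv n m G G' \<and> (\<forall>i k. i < l \<longrightarrow> i < k \<longrightarrow> k < m \<longrightarrow> G' i k = 0)" for l
  proof (induction l)
    case 0
    show ?case by (intro exI [of _ G] conjI orth_equiv_refl) auto
  next
    case (Suc l)
    then obtain F where F: "orth_equiv n m G F"
      and F1: "\<And>i k. i < l \<Longrightarrow> i < k \<Longrightarrow> k < m \<Longrightarrow> F i k = 0"
      by blast
    from orth_equiv_clear_row [where G = F and i = l and m = m and n = n and l = m, OF F1] obtain F' where
      F': "orth_equiv n m F F'" "\<And>i' k. i' < l \<Longrightarrow> i' < k \<Longrightarrow> k < m \<Longrightarrow> F' i' k = 0"
      "\<And>k. l < k \<Longrightarrow> k < m \<Longrightarrow> F' l k = 0"
      by blast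
    have "\<forall>i k. i < Suc l \<longrightarrow> i < k \<longrightarrow> k < m \<longrightarrow> F' i k = 0"
      using F' less_Suc_eq by auto
    then show ?case
      using orth_equiv_trans [OF F F'(1)] by blast
  qed
  from this [of l] obtain G' where
    "orth_equiv n m G G' \<and> (\<forall>i k. i < l \<longrightarrow> i < k \<longrightarrow> k < m \<longrightarrow> G' i k = 0)" ..
  then show ?thesis
    by (intro that [of G']) auto
qed

lemma gauss_law_drop_columns:
  assumes "m' \<le> m" "\<And>i k. i < n \<Longrightarrow> m' \<le> k \<Longrightarrow> k < m \<Longrightarrow> G i k = 0"
  shows "gauss_law n m G = gauss_law n m' G"
proof -
  interpret product_prob_space "\<lambda>_. std_normal" "{..<m}"
    by (simp add: product_prob_space_def product_prob_space_axioms_def product_sigma_finite_def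
        prob_space_std_normal prob_space_imp_sigma_finite)
  have *: "distr (std_normal_vec {..<m}) (std_normal_vec {..<m'}) (\<lambda>z. restrict z {..<m'}) = std_normal_vec {..<m'}"
    unfolding std_normal_vec_def by (rule distr_PiM_restrict_finite) (use assms in auto)
  have meas: "(\<lambda>z. restrict z {..<m'}) \<in> measurable (std_normal_vec {..<m}) (std_normal_vec {..<m'})"
    unfolding std_normal_vec_def by (rule measurable_restrict_subset) (use assms in auto)
  have lin: "(\<lambda>i\<in>{..<n}. \<Sum>j<m'. G i j * restrict z {..<m'} j) = (\<lambda>i\<in>{..<n}. \<Sum>j<m. G i j * z j)" for z
  proof (rule restrict_ext)
    fix i assume "i \<in> {..<n}"
    then show "(\<Sum>j<m'. G i j * restrict z {..<m'} j) = (\<Sum>j<m. G i j * z j)"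
      using assms by (intro sum.mono_neutral_cong_left) auto
  qed
  have "gauss_law n m' G = distr (distr (std_normal_vec {..<m}) (std_normal_vec {..<m'}) (\<lambda>z. restrict z {..<m'})) (Rn n)
     (\<lambda>z. \<lambda>i\<in>{..<n}. \<Sum>j<m'. G i j * z j)"
    unfolding * gauss_law_def ..
  also have "\<dots> = gauss_law n m G"
    unfolding gauss_law_def distr_distr [OF measurable_lin meas] comp_def lin ..
  finally show ?thesis ..
qed

lemma gauss_law_square:
  assumes "n \<le> m"
  obtains L where "gauss_law n m G = gauss_law n n L"
    "\<And>i i'. i < n \<Longrightarrow> i' < n \<Longrightarrow> (\<Sum>j<m. G i j * G i' j) = (\<Sum>j<n. L i j * L i' j)"
proof -
  obtain L where L: "orth_equiv n m G L" "\<And>i k. i < k \<Longrightarrow> k < m \<Longrightarrow> i < n \<Longrightarrow> L i k = 0"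
    using orth_equiv_lower_triangular [of n m G n] by blast
  have "gauss_law n m G = gauss_law n n L"
    using L assms gauss_law_drop_columns [of n m n L] by (simp add: orth_equiv_def)
  moreover have "(\<Sum>j<m. G i j * G i' j) = (\<Sum>j<n. L i j * L i' j)" if "i < n" "i' < n" for i i'
  proof -
    have "(\<Sum>j<m. L i j * L i' j) = (\<Sum>j<n. L i j * L i' j)"
      using L(2) that assms by (intro sum.mono_neutral_right) auto
    then show ?thesis using L(1) by (simp add: orth_equiv_def)
  qed
  ultimately show ?thesis using that by blast
qed

section \<open>Second moments and sign symmetry of linear forms\<close>

lemma nn_integral_std_normal_square: "(\<integral>\<^sup>+x. ennreal (x\<^sup>2) \<partial>std_normal) = 1"
proof -
  have "(\<integral>\<^sup>+x. ennreal (x\<^sup>2) \<partial>std_normal) = (\<integral>\<^sup>+x. ennreal (std_normal_density x * x ^ (2 * 1)) \<partial>lborel)"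
    by (subst nn_integral_density) (auto simp: ennreal_mult')
  also have "\<dots> = ennreal 1"
    using std_normal_moment_even [of 1]
    by (subst nn_integral_eq_integral) (auto simp: has_bochner_integral_iff)
  finally show ?thesis by simp
qed

lemma nn_integral_std_normal_component:
  assumes "i \<in> I" and [measurable]: "f \<in> borel_measurable borel"
  shows "(\<integral>\<^sup>+z. f (z i) \<partial>std_normal_vec I) = (\<integral>\<^sup>+x. f x \<partial>std_normal)"
proof -
  have "distr (std_normal_vec I) std_normal (\<lambda>z. z i) = std_normal"
    unfolding std_normal_vec_def by (rule distr_PiM_component) (use assms prob_space_std_normal in auto)
  then have "(\<integral>\<^sup>+x. f x \<partial>std_normal) = (\<integral>\<^sup>+x. f x \<partial>distr (std_normal_vec I) std_normal (\<lambda>z. z i))"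
    by simp
  also have "\<dots> = (\<integral>\<^sup>+z. f (z i) \<partial>std_normal_vec I)"
    using assms by (subst nn_integral_distr) auto
  finally show ?thesis ..
qed

text \<open>The coefficient vector is a matrix with a single row, which the triangular reduction
  shrinks to one entry of the same square sum; no mixed moments have to be computed.\<close>

lemma nn_integral_std_normal_vec_lin_square:
  "(\<integral>\<^sup>+z. ennreal ((\<Sum>j<m. a j * z j)\<^sup>2) \<partial>std_normal_vec {..<m}) = ennreal (\<Sum>j<m. (a j)\<^sup>2)"
proof (cases "m = 0")
  case True
  then show ?thesis by simp
next
  case False
  then have "1 \<le> m" by simp
  from gauss_law_square [OF this, of "\<lambda>_. a"] obtain L
    where L: "gauss_law 1 m (\<lambda>_. a) = gauss_law 1 1 L"
      "\<And>i i'. i < 1 \<Longrightarrow> i' < 1 \<Longrightarrow> (\<Sum>j<m. a j * a j) = (\<Sum>j<1. L i j * L i' j)"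
    by blast
  have meas: "(\<lambda>x. ennreal ((x 0)\<^sup>2)) \<in> borel_measurable (Rn 1)"
    unfolding Rn_def by measurable
  have "(\<integral>\<^sup>+z. ennreal ((\<Sum>j<m. a j * z j)\<^sup>2) \<partial>std_normal_vec {..<m}) = (\<integral>\<^sup>+x. ennreal ((x 0)\<^sup>2) \<partial>gauss_law 1 m (\<lambda>_. a))"
    by (subst nn_integral_gauss_law [OF meas]) auto
  also have "\<dots> = (\<integral>\<^sup>+z. ennreal ((L 0 0)\<^sup>2) * ennreal ((z 0)\<^sup>2) \<partial>std_normal_vec {..<1})"
    unfolding L(1) by (subst nn_integral_gauss_law [OF meas]) (auto simp: power_mult_distrib ennreal_mult')
  also have "\<dots> = ennreal ((L 0 0)\<^sup>2)"
    by (subst nn_integral_cmult)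
      (auto simp: nn_integral_std_normal_square nn_integral_std_normal_component [where f = "\<lambda>x. ennreal (x\<^sup>2)"])
  finally show ?thesis using L(2) [of 0 0] by (simp add: power2_eq_square)
qed

text \<open>After a triangular reduction of the rows \<open>a, b 0, b 1, \<dots>\<close>, the first row only involves
  the coordinate \<open>z 0\<close> and, by orthogonality, the other rows do not; then flip the sign of \<open>z 0\<close>.\<close>
lemma nn_integral_std_normal_vec_flip:
  fixes f :: "real \<Rightarrow> (nat \<Rightarrow> real) \<Rightarrow> ennreal"
  assumes orth: "\<And>i. i < n \<Longrightarrow> (\<Sum>j<m. a j * b i j) = 0"
    and [measurable]: "case_prod f \<in> borel_measurable (borel \<Otimes>\<^sub>M Rn n)"
  shows "(\<integral>\<^sup>+z. f (\<Sum>j<m. a j * z j) (\<lambda>i\<in>{..<n}. \<Sum>j<m. b i j * z j) \<partial>std_normal_vec {..<m})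
    = (\<integral>\<^sup>+z. f (- (\<Sum>j<m. a j * z j)) (\<lambda>i\<in>{..<n}. \<Sum>j<m. b i j * z j) \<partial>std_normal_vec {..<m})"
proof (cases "m = 0")
  case True
  then show ?thesis by simp
next
  case False
  then have m: "0 < m" by simp
  define G where "G i = (case i of 0 \<Rightarrow> a | Suc i \<Rightarrow> b i)" for i
  obtain L where L: "orth_equiv (Suc n) m G L" "\<And>i k. i < k \<Longrightarrow> k < m \<Longrightarrow> i < Suc n \<Longrightarrow> L i k = 0"
    using orth_equiv_lower_triangular [of "Suc n" m G "Suc n"] by blast
  have row0: "(\<Sum>j<m. L 0 j * w j) = L 0 0 * w 0" for w
  proof -
    have "(\<Sum>j<m. L 0 j * w j) = (\<Sum>j\<in>{0}. L 0 j * w j)"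
      using L(2) [of 0] m by (intro sum.mono_neutral_right) auto
    then show ?thesis by simp
  qed
  \<comment> \<open>Row 0 of \<open>L\<close> is supported on column 0, so its preserved Gram entry
    with row \<open>Suc i\<close> collapses to this single product.\<close>
  have orth': "L 0 0 * L (Suc i) 0 = 0" if "i < n" for i
  proof -
    have "(\<Sum>j<m. L 0 j * L (Suc i) j) = (\<Sum>j<m. G 0 j * G (Suc i) j)"
      using L(1) by (simp add: orth_equiv_def)
    also have "\<dots> = 0"
      using orth [OF that] by (simp add: G_def)
    finally show ?thesis by (simp add: row0)
  qed
  define F where "F s x = f (s * x 0) (\<lambda>i\<in>{..<n}. x (Suc i))" for s and x :: "nat \<Rightarrow> real"
  have F: "F s \<in> borel_measurable (Rn (Suc n))" for s
  proof -
    have [measurable]: "(\<lambda>x. \<lambda>i\<in>{..<n}. x (Suc i)) \<in> measurable (Rn (Suc n)) (Rn n)"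
      unfolding Rn_def by (intro measurable_restrict measurable_component_singleton) auto
    have [measurable]: "(\<lambda>x. x 0) \<in> borel_measurable (Rn (Suc n))"
      unfolding Rn_def by (intro measurable_component_singleton) auto
    have "(\<lambda>x. case_prod f (s * x 0, \<lambda>i\<in>{..<n}. x (Suc i))) \<in> borel_measurable (Rn (Suc n))"
      by measurable
    then show ?thesis by (simp add: F_def [abs_def])
  qed
  have law: "(\<integral>\<^sup>+z. f (s * (\<Sum>j<m. a j * z j)) (\<lambda>i\<in>{..<n}. \<Sum>j<m. b i j * z j) \<partial>std_normal_vec {..<m})
     = (\<integral>\<^sup>+z. f (s * (L 0 0 * z 0)) (\<lambda>i\<in>{..<n}. \<Sum>j<m. L (Suc i) j * z j) \<partial>std_normal_vec {..<m})" for s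
  proof -
    have "(\<integral>\<^sup>+x. F s x \<partial>gauss_law (Suc n) m G) = (\<integral>\<^sup>+x. F s x \<partial>gauss_law (Suc n) m L)"
      using L(1) by (simp add: orth_equiv_def)
    then show ?thesis
      unfolding nn_integral_gauss_law [OF F] by (simp add: F_def G_def row0 cong: restrict_cong)
  qed
  show ?thesis
  proof (cases "L 0 0 = 0")
    case True
    then show ?thesis using law [of 1] law [of "-1"] by simp
  next
    case False
    define K where "K = {..<m} - {0}"
    have K: "finite K" "0 \<notin> K" "{..<m} = insert 0 K"
      using m by (auto simp: K_def)
    have b: "(\<Sum>j<m. L (Suc i) j * z j) = (\<Sum>j\<in>K. L (Suc i) j * z j)" if "i < n" for i z
      using orth' [OF that] False K by simp
    define g where "g s z = f (s * (L 0 0 * z 0)) (\<lambda>i\<in>{..<n}. \<Sum>j\<in>K. L (Suc i) j * z j)" for s z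
    have [measurable]: "g s \<in> borel_measurable (PiM (insert 0 K) (\<lambda>_. borel))" for s
    proof -
      have [measurable]: "(\<lambda>z. \<lambda>i\<in>{..<n}. \<Sum>j\<in>K. L (Suc i) j * z j) \<in> measurable (PiM (insert 0 K) (\<lambda>_. borel)) (Rn n)"
        unfolding Rn_def by measurable
      have "(\<lambda>x. case_prod f (s * (L 0 0 * x 0), \<lambda>i\<in>{..<n}. \<Sum>j\<in>K. L (Suc i) j * x j)) \<in> borel_measurable (PiM (insert 0 K) (\<lambda>_. borel))"
        by measurable
      then show ?thesis by (simp add: g_def [abs_def])
    qed
    have gm: "(\<integral>\<^sup>+z. g s z \<partial>std_normal_vec {..<m})
      = (\<integral>\<^sup>+z. f (s * (\<Sum>j<m. a j * z j)) (\<lambda>i\<in>{..<n}. \<Sum>j<m. b i j * z j) \<partial>std_normal_vec {..<m})" for s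
      unfolding law g_def by (simp add: b cong: restrict_cong)
    have sym: "(\<integral>\<^sup>+s. h (- s) \<partial>std_normal) = (\<integral>\<^sup>+s. h s \<partial>std_normal)"
      if [measurable]: "h \<in> borel_measurable borel" for h :: "real \<Rightarrow> ennreal"
    proof -
      have "(\<integral>\<^sup>+s. h s \<partial>std_normal) = (\<integral>\<^sup>+s. std_normal_density s * h s \<partial>lborel)"
        by (simp add: nn_integral_density)
      also have "\<dots> = (\<integral>\<^sup>+s. std_normal_density (- s) * h (- s) \<partial>lborel)"
        using nn_integral_real_affine [of "\<lambda>s. std_normal_density s * h s" "-1" 0] by simp
      also have "\<dots> = (\<integral>\<^sup>+s. h (- s) \<partial>std_normal)"
        by (simp add: nn_integral_density std_normal_density_def)
      finally show ?thesis ..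
    qed
    have "(\<integral>\<^sup>+z. g 1 z \<partial>std_normal_vec {..<m}) = (\<integral>\<^sup>+z. \<integral>\<^sup>+s. g 1 (z(0 := s)) \<partial>std_normal \<partial>std_normal_vec K)"
      unfolding K(3) by (rule nn_integral_std_normal_vec_insert [OF K(1,2)]) measurable
    also have "\<dots> = (\<integral>\<^sup>+z. \<integral>\<^sup>+s. g (-1) (z(0 := s)) \<partial>std_normal \<partial>std_normal_vec K)"
    proof (rule nn_integral_cong)
      fix z assume "z \<in> space (std_normal_vec K)"
      then have z: "z \<in> space (PiM K (\<lambda>_. borel))"
        by (simp add: space_std_normal_vec space_PiM PiE_def)
      have [measurable]: "(\<lambda>s::real. z(0 := s)) \<in> measurable borel (PiM (insert 0 K) (\<lambda>_. borel))"
        by (rule measurable_fun_upd [where J = K]) (use z in auto)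
      have "g 1 (z(0 := - s)) = g (-1) (z(0 := s))" for s
        using K(2) by (auto simp: g_def intro!: arg_cong2 [of _ _ _ _ f] restrict_ext sum.cong)
      then show "(\<integral>\<^sup>+s. g 1 (z(0 := s)) \<partial>std_normal) = (\<integral>\<^sup>+s. g (-1) (z(0 := s)) \<partial>std_normal)"
        using sym [of "\<lambda>s. g 1 (z(0 := s))"] by simp
    qed
    also have "\<dots> = (\<integral>\<^sup>+z. g (-1) z \<partial>std_normal_vec {..<m})"
      unfolding K(3) by (rule nn_integral_std_normal_vec_insert [OF K(1,2), symmetric]) measurable
    finally show ?thesis
      by (simp add: gm)
  qed
qed

section \<open>A minimax theorem for families of quadratics\<close>

text \<open>Vectors and matrices are total functions on infinite index types, so compactness comes
  from Tychonoff's theorem.\<close>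

lemma compact_box: "compact {x :: 'i::countable \<Rightarrow> 'a::metric_space. \<forall>i. x i \<in> C i}"
  if "\<And>i. compact (C i)"
proof -
  have "compactin (product_topology (\<lambda>_. euclidean) UNIV) (PiE UNIV C)"
    using that by (simp add: compactin_PiE)
  moreover have "PiE UNIV C = {x. \<forall>i. x i \<in> C i}"
    by auto
  ultimately show ?thesis
    by (simp add: euclidean_product_topology)
qed

text \<open>First-order condition for a one-sided minimum at \<open>t = 0\<close>: divide by
  \<open>t\<close> and let \<open>t\<close> tend to 0 from above.\<close>

lemma quadratic_nonneg_imp_linear_nonneg:
  fixes a b :: real
  assumes "\<And>t. 0 < t \<Longrightarrow> t \<le> 1 \<Longrightarrow> 0 \<le> 2 * t * a + t\<^sup>2 * b"
  shows "0 \<le> a"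
proof -
  have "0 \<le> 2 * a + t * b" if "t \<in> {0<..1}" for t
  proof -
    have "0 \<le> t * (2 * a + t * b)"
      using assms [of t] that by (simp add: power2_eq_square algebra_simps)
    then show ?thesis using that by (simp add: zero_le_mult_iff)
  qed
  then have "\<forall>\<^sub>F t in at_right 0. 0 \<le> 2 * a + t * b"
    unfolding eventually_at_right_field by (intro exI [of _ 1]) auto
  moreover have "((\<lambda>t. 2 * a + t * b) \<longlongrightarrow> 2 * a + 0 * b) (at_right 0)"
    by (intro tendsto_intros)
  ultimately have "0 \<le> 2 * a + 0 * b"
    by (intro tendsto_lowerbound [of "\<lambda>t. 2 * a + t * b" _ "at_right 0"]) auto
  then show ?thesis by simp
qed

text \<open>The point \<open>k\<close> minimises the upper envelope of the quadratics \<open>f \<cdot> s\<close>; among the indices \<open>s\<close>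
  attaining the maximum at \<open>k\<close> take one whose gradient has minimal norm. If that gradient \<open>g\<close> did not
  vanish, then moving \<open>k\<close> a little in the direction \<open>- g\<close> would lower the envelope, since by minimality
  every maximising gradient has inner product at least \<open>|g|\<^sup>2\<close> with \<open>g\<close>.\<close>
theorem quadratic_minimax:
  fixes f :: "('i::countable \<Rightarrow> real) \<Rightarrow> 's::metric_space \<Rightarrow> real"
    and g :: "('i \<Rightarrow> real) \<Rightarrow> 's \<Rightarrow> 'i \<Rightarrow> real" and h :: "('i \<Rightarrow> real) \<Rightarrow> 's \<Rightarrow> real"
  assumes I: "finite I" and S: "compact S"
    and expand: "\<And>k d t s. s \<in> S \<Longrightarrow>
      f (\<lambda>i. k i + t * d i) s = f k s + 2 * t * (\<Sum>i\<in>I. g k s i * d i) + t\<^sup>2 * h d s"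
    and local: "\<And>k s. s \<in> S \<Longrightarrow> f (\<lambda>i. if i \<in> I then k i else 0) s = f k s"
    and cont_k: "\<And>s. s \<in> S \<Longrightarrow> continuous_on UNIV (\<lambda>k. f k s)"
    and cont_f: "\<And>k. continuous_on S (f k)"
    and cont_g: "\<And>k i. i \<in> I \<Longrightarrow> continuous_on S (\<lambda>s. g k s i)"
    and cont_h: "\<And>d. continuous_on S (h d)"
    and coercive: "s0 \<in> S" "0 < c" "\<And>k i. i \<in> I \<Longrightarrow> c * (k i)\<^sup>2 \<le> f k s0"
    and nonneg: "\<And>k. 0 \<le> f k s0"
    and mix: "\<And>k s s' t. s \<in> S \<Longrightarrow> s' \<in> S \<Longrightarrow> 0 \<le> t \<Longrightarrow> t \<le> 1 \<Longrightarrow> \<exists>u\<in>S.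
       f k u = (1 - t) * f k s + t * f k s' \<and> (\<forall>i\<in>I. g k u i = (1 - t) * g k s i + t * g k s' i)"
  obtains k s where "s \<in> S" "\<And>s'. s' \<in> S \<Longrightarrow> f k s' \<le> f k s" "\<And>i. i \<in> I \<Longrightarrow> g k s i = 0"
proof -
  have "\<exists>s\<in>S. \<forall>s'\<in>S. f k s' \<le> f k s" for k
    using continuous_attains_sup [OF S _ cont_f] coercive(1) by blast
  then obtain m where m: "\<And>k. m k \<in> S" "\<And>k s. s \<in> S \<Longrightarrow> f k s \<le> f k (m k)"
    by metis
  define \<phi> where "\<phi> k = f k (m k)" for k
  have \<phi>0: "0 \<le> \<phi> k" for k
    using nonneg [of k] m(2) [OF coercive(1), of k] by (simp add: \<phi>_def)
  have bdd: "bdd_below (range \<phi>)"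
    using \<phi>0 by (intro bdd_belowI [of _ 0]) auto
  define v where "v = (INF k. \<phi> k)"
  have v: "v \<le> \<phi> k" for k
    unfolding v_def by (rule cINF_lower [OF bdd]) simp
  have "\<exists>k. \<phi> k < v + 1 / real (Suc n)" for n
    using cINF_less_iff [of UNIV \<phi> "v + 1 / real (Suc n)"] bdd by (simp add: v_def)
  then obtain K where K: "\<And>n. \<phi> (K n) < v + 1 / real (Suc n)"
    by metis
  \<comment> \<open>Zeroing the coordinates outside \<open>I\<close> changes no value of
    \<open>f\<close> and confines the whole minimising sequence to a box, whose radius
    \<open>R\<close> solves \<open>c * R^2 = v + 1\<close>.\<close>
  define K' where "K' n i = (if i \<in> I then K n i else 0)" for n i
  have fK': "f (K' n) s = f (K n) s" if "s \<in> S" for n s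
    using local [OF that] by (simp add: K'_def [abs_def])
  define R where "R = sqrt ((v + 1) / c)"
  have "K' n \<in> {x. \<forall>i. x i \<in> {-R..R}}" for n
  proof -
    have v0: "0 \<le> v"
      unfolding v_def using \<phi>0 by (intro cINF_greatest) auto
    have "\<bar>K' n i\<bar> \<le> R" for i
    proof (cases "i \<in> I")
      case True
      have "c * (K' n i)\<^sup>2 \<le> f (K' n) s0"
        by (rule coercive(3) [OF True])
      also have "\<dots> \<le> \<phi> (K n)"
        using m(2) coercive(1) by (simp add: \<phi>_def fK')
      also have "\<dots> \<le> v + 1"
      proof -
        have "1 / real (Suc n) \<le> 1" by simp
        then show ?thesis using K [of n] by linarith
      qed
      finally have "(K' n i)\<^sup>2 \<le> (v + 1) / c"
        using coercive(2) by (simp add: field_simps)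
      then show ?thesis
        unfolding R_def using real_le_rsqrt by fastforce
    next
      case False
      then show ?thesis using v0 coercive(2) by (simp add: K'_def R_def)
    qed
    then show ?thesis by (auto simp: abs_le_iff minus_le_iff)
  qed
  then obtain k r where r: "strict_mono r" and lim: "(K' \<circ> r) \<longlonglongrightarrow> k"
    using compact_imp_seq_compact [OF compact_box [of "\<lambda>_::'i. {-R..R}"]]
    by (auto simp: seq_compact_def elim!: allE [of _ K'])
  \<comment> \<open>The limit is taken for each \<open>s\<close> separately, so continuity of
    \<open>f\<close> in \<open>k\<close> suffices and the envelope itself need not be
    continuous.\<close>
  have le_v: "f k s \<le> v" if "s \<in> S" for s
  proof (rule LIMSEQ_le)
    have "isCont (\<lambda>k. f k s) k"
      using cont_k [OF that] by (simp add: continuous_on_eq_continuous_at)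
    then show "(\<lambda>n. f (K' (r n)) s) \<longlonglongrightarrow> f k s"
      using lim isCont_tendsto_compose by (fastforce simp: comp_def)
    show "(\<lambda>n. v + 1 / real (Suc n)) \<longlonglongrightarrow> v"
      using LIMSEQ_inverse_real_of_nat_add [of v] by (simp add: inverse_eq_divide)
    have "f (K' (r n)) s \<le> v + 1 / real (Suc n)" for n
    proof -
      have "f (K' (r n)) s \<le> \<phi> (K (r n))"
        using m(2) that by (simp add: \<phi>_def fK')
      also have "\<dots> \<le> v + 1 / real (Suc (r n))"
        using K less_imp_le by blast
      also have "\<dots> \<le> v + 1 / real (Suc n)"
        using seq_suble [OF r, of n] by (simp add: frac_le)
      finally show ?thesis .
    qed
    then show "\<exists>N. \<forall>n\<ge>N. f (K' (r n)) s \<le> v + 1 / real (Suc n)" by blast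
  qed
  define M where "M = {s \<in> S. f k s = v}"
  have "m k \<in> M"
    using m v [of k] le_v [of "m k"] by (simp add: M_def \<phi>_def antisym)
  have "closed M"
    unfolding M_def using continuous_closed_preimage_constant [OF cont_f compact_imp_closed [OF S]] .
  then have "compact (S \<inter> M)"
    using S by (intro compact_Int_closed)
  then have M: "compact M"
    by (simp add: M_def Int_def)
  have "continuous_on M (\<lambda>s. \<Sum>i\<in>I. (g k s i)\<^sup>2)"
    by (intro continuous_intros continuous_on_subset [OF cont_g]) (auto simp: M_def)
  then obtain s where s: "s \<in> M" "\<And>s'. s' \<in> M \<Longrightarrow> (\<Sum>i\<in>I. (g k s i)\<^sup>2) \<le> (\<Sum>i\<in>I. (g k s' i)\<^sup>2)"
    using continuous_attains_inf [OF M] \<open>m k \<in> M\<close> by blast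
  let ?g = "g k s"
  \<comment> \<open>Variational inequality for the point of least norm in a convex set: by
    \<open>mix\<close>, any convex combination of gradients at two maximisers is again the gradient
    at some maximiser.\<close>
  have angle: "(\<Sum>i\<in>I. (?g i)\<^sup>2) \<le> (\<Sum>i\<in>I. ?g i * g k s' i)" if s': "s' \<in> M" for s'
  proof -
    have "0 \<le> (\<Sum>i\<in>I. ?g i * (g k s' i - ?g i))"
    proof (rule quadratic_nonneg_imp_linear_nonneg)
      fix t :: real assume t: "0 < t" "t \<le> 1"
      obtain u where u: "u \<in> S" "f k u = (1 - t) * f k s + t * f k s'"
        "\<And>i. i \<in> I \<Longrightarrow> g k u i = (1 - t) * g k s i + t * g k s' i"
        using mix [of s s' t k] s s' t by (auto simp: M_def)
      have "u \<in> M"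
        using u s s' by (simp add: M_def algebra_simps)
      then have "(\<Sum>i\<in>I. (?g i)\<^sup>2) \<le> (\<Sum>i\<in>I. (g k u i)\<^sup>2)"
        by (rule s(2))
      also have "\<dots> = (\<Sum>i\<in>I. (?g i)\<^sup>2 + 2 * t * (?g i * (g k s' i - ?g i)) + t\<^sup>2 * (g k s' i - ?g i)\<^sup>2)"
        by (rule sum.cong) (simp_all add: u power2_eq_square algebra_simps)
      finally show "0 \<le> 2 * t * (\<Sum>i\<in>I. ?g i * (g k s' i - ?g i)) + t\<^sup>2 * (\<Sum>i\<in>I. (g k s' i - ?g i)\<^sup>2)"
        by (simp add: sum.distrib sum_distrib_left)
    qed
    then show ?thesis
      by (simp add: algebra_simps sum_subtractf power2_eq_square)
  qed
  let ?d = "\<lambda>i. - ?g i"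
  define t where "t n = 1 / real (Suc n)" for n
  have t: "0 < t n" for n by (simp add: t_def)
  have t0: "t \<longlonglongrightarrow> 0"
    unfolding t_def using LIMSEQ_inverse_real_of_nat by (simp add: inverse_eq_divide)
  \<comment> \<open>Indices that are maximal at points displaced along \<open>- g\<close>. A cluster
    point \<open>s1\<close> of them is still maximal at \<open>k\<close>, while minimality of
    \<open>v\<close> prevents its gradient from pointing downhill along \<open>- g\<close>.\<close>
  define p where "p n = m (\<lambda>i. k i + t n * ?d i)" for n
  have p: "p n \<in> S" for n by (simp add: p_def m)
  obtain s1 q where s1: "s1 \<in> S" and q: "strict_mono q" and lim1: "(p \<circ> q) \<longlonglongrightarrow> s1"
    using compact_imp_seq_compact [OF S] p by (auto simp: seq_compact_def elim!: allE [of _ p])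
  have tq: "(\<lambda>n. t (q n)) \<longlonglongrightarrow> 0"
    using LIMSEQ_subseq_LIMSEQ [OF t0 q] by (simp add: comp_def)
  have along: "(\<lambda>n. F (p (q n))) \<longlonglongrightarrow> F s1" if "continuous_on S F" for F :: "'s \<Rightarrow> real"
    using continuous_on_tendsto_compose [OF that, of "\<lambda>n. p (q n)" s1] lim1 s1 p by (simp add: comp_def)
  have low: "v \<le> f k (p n) + 2 * t n * (\<Sum>i\<in>I. g k (p n) i * ?d i) + (t n)\<^sup>2 * h ?d (p n)" for n
    using v [of "\<lambda>i. k i + t n * ?d i"] expand [OF p, of k "t n" ?d n] by (simp add: \<phi>_def p_def)
  have cont_gd: "continuous_on S (\<lambda>s. \<Sum>i\<in>I. g k s i * ?d i)"
    by (intro continuous_intros cont_g)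
  note lims = along [OF cont_f] along [OF cont_gd] along [OF cont_h] tq
    tendsto_add tendsto_mult tendsto_power tendsto_const
  have "(\<lambda>n. f k (p (q n)) + 2 * t (q n) * (\<Sum>i\<in>I. g k (p (q n)) i * ?d i) + (t (q n))\<^sup>2 * h ?d (p (q n)))
    \<longlonglongrightarrow> f k s1 + 2 * 0 * (\<Sum>i\<in>I. g k s1 i * ?d i) + 0\<^sup>2 * h ?d s1"
    by (intro lims)
  then have "v \<le> f k s1 + 2 * 0 * (\<Sum>i\<in>I. g k s1 i * ?d i) + 0\<^sup>2 * h ?d s1"
    by (rule LIMSEQ_le_const) (use low in blast)
  then have "s1 \<in> M"
    using le_v [OF s1] s1 by (simp add: M_def)
  \<comment> \<open>The bounds \<open>v \<le> f\<close> at the displaced point and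
    \<open>f \<le> v\<close> at \<open>k\<close> cancel the zeroth-order terms; what remains is
    divided by \<open>t n > 0\<close>.\<close>
  have "0 \<le> 2 * (\<Sum>i\<in>I. g k (p n) i * ?d i) + t n * h ?d (p n)" for n
  proof -
    have "0 \<le> t n * (2 * (\<Sum>i\<in>I. g k (p n) i * ?d i) + t n * h ?d (p n))"
      using low [of n] le_v [OF p, of n] by (simp add: power2_eq_square algebra_simps)
    then show ?thesis using t [of n] by (simp add: zero_le_mult_iff)
  qed
  moreover have "(\<lambda>n. 2 * (\<Sum>i\<in>I. g k (p (q n)) i * ?d i) + t (q n) * h ?d (p (q n)))
    \<longlonglongrightarrow> 2 * (\<Sum>i\<in>I. g k s1 i * ?d i) + 0 * h ?d s1"
    by (intro lims)
  ultimately have "0 \<le> 2 * (\<Sum>i\<in>I. g k s1 i * ?d i) + 0 * h ?d s1"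
    by (intro LIMSEQ_le_const) blast+
  then have "(\<Sum>i\<in>I. ?g i * g k s1 i) \<le> 0"
    by (simp add: sum_negf mult.commute)
  with angle [OF \<open>s1 \<in> M\<close>] have "(\<Sum>i\<in>I. (?g i)\<^sup>2) \<le> 0"
    by simp
  then have "(\<Sum>i\<in>I. (?g i)\<^sup>2) = 0"
    by (intro antisym sum_nonneg) auto
  then have "\<And>i. i \<in> I \<Longrightarrow> g k s i = 0"
    using I by (simp add: sum_nonneg_eq_0_iff)
  moreover have "s \<in> S" "\<And>s'. s' \<in> S \<Longrightarrow> f k s' \<le> f k s"
    using s(1) le_v by (auto simp: M_def)
  ultimately show ?thesis by (rule that [rotated 2])
qed

section \<open>Worst-case second moments over a Wasserstein ball\<close>

text \<open>A convex function is maximised here, yet the multiplier is exact. If the gradient at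
  \<open>x\<close> vanishes, then \<open>q\<close> is zero on the ball and hence everywhere.
  Otherwise \<open>x\<close> lies on the sphere with gradient parallel to \<open>x - x0\<close>, and
  comparison with the far ends of chords through \<open>x\<close> gives
  \<open>q y \<le> \<gamma> * |y|^2\<close>, which makes the Lagrangian concave.\<close>

lemma trust_region_multiplier:
  fixes e :: "'v \<Rightarrow> 'u \<Rightarrow> real" and U :: "'u set" and V :: "'v set"
  defines "q \<equiv> \<lambda>y. \<Sum>v\<in>V. (\<Sum>u\<in>U. e v u * y u)\<^sup>2"
  assumes fin: "finite U" "finite V" and \<rho>: "0 < \<rho>"
    and ball: "(\<Sum>u\<in>U. (x u - x0 u)\<^sup>2) \<le> \<rho>\<^sup>2"
    and max: "\<And>y. (\<Sum>u\<in>U. (y u - x0 u)\<^sup>2) \<le> \<rho>\<^sup>2 \<Longrightarrow> q y \<le> q x"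
  obtains \<gamma> where "0 \<le> \<gamma>"
    "\<And>u. u \<in> U \<Longrightarrow> (\<Sum>v\<in>V. e v u * (\<Sum>w\<in>U. e v w * x w)) = \<gamma> * (x u - x0 u)"
    "\<And>y. q y \<le> \<gamma> * (\<Sum>u\<in>U. (y u)\<^sup>2)"
    "\<gamma> * (\<Sum>u\<in>U. (x u - x0 u)\<^sup>2) = \<gamma> * \<rho>\<^sup>2"
proof -
  define E where "E v y = (\<Sum>u\<in>U. e v u * y u)" for v y
  define B where "B y z = (\<Sum>v\<in>V. E v y * E v z)" for y z
  define G where "G u = (\<Sum>v\<in>V. e v u * E v x)" for u
  define D where "D u = x u - x0 u" for u
  define ip where "ip y z = (\<Sum>u\<in>U. y u * z u)" for y z :: "'u \<Rightarrow> real"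
  have q: "q y = B y y" for y
    by (simp add: q_def B_def E_def power2_eq_square)
  have q0: "0 \<le> q y" for y
    by (simp add: q_def sum_nonneg)
  have E_add: "E v (\<lambda>u. y u + t * z u) = E v y + t * E v z" for v y z t
    by (simp add: E_def algebra_simps sum.distrib sum_distrib_left)
  have q_add: "q (\<lambda>u. y u + t * z u) = q y + 2 * t * B y z + t\<^sup>2 * q z" for y z t
    unfolding q B_def E_add
    by (simp add: algebra_simps sum.distrib sum_distrib_left power2_eq_square)
  have ip_add: "ip (\<lambda>u. y u + t * z u) (\<lambda>u. y u + t * z u) = ip y y + 2 * t * ip y z + t\<^sup>2 * ip z z" for y z t
    by (simp add: ip_def algebra_simps sum.distrib sum_distrib_left power2_eq_square)
  have ip0: "0 \<le> ip y y" for y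
    by (simp add: ip_def sum_nonneg)
  have adj: "ip G y = B x y" for y
  proof -
    have "ip G y = (\<Sum>u\<in>U. \<Sum>v\<in>V. E v x * (e v u * y u))"
      by (simp add: ip_def G_def sum_distrib_left sum_distrib_right mult_ac)
    also have "\<dots> = (\<Sum>v\<in>V. \<Sum>u\<in>U. E v x * (e v u * y u))"
      by (rule sum.swap)
    finally show ?thesis
      by (simp add: B_def E_def sum_distrib_left)
  qed
  have ball': "ip D D \<le> \<rho>\<^sup>2"
    using ball by (simp add: ip_def D_def power2_eq_square)
  have max': "2 * t * ip G z + t\<^sup>2 * q z \<le> 0"
    if "ip D D + 2 * t * ip D z + t\<^sup>2 * ip z z \<le> \<rho>\<^sup>2" for t z
  proof -
    have "(\<Sum>u\<in>U. (x u + t * z u - x0 u)\<^sup>2) = ip (\<lambda>u. D u + t * z u) (\<lambda>u. D u + t * z u)"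
      by (simp add: ip_def D_def power2_eq_square algebra_simps)
    then have "q (\<lambda>u. x u + t * z u) \<le> q x"
      using that by (intro max) (simp add: ip_add)
    then show ?thesis by (simp add: q_add adj)
  qed
  define s where "s = sqrt (ip G G)"
  have s: "0 \<le> s" "s\<^sup>2 = ip G G"
    using ip0 by (simp_all add: s_def)
  \<comment> \<open>\<open>s\<close> is the length of half the gradient, and \<open>\<rho>\<close>
    that of \<open>D\<close> on the sphere; \<open>G = \<gamma> * D\<close> forces their
    ratio.\<close>
  define \<gamma> where "\<gamma> = s / \<rho>"
  have \<gamma>: "0 \<le> \<gamma>" "\<gamma> * \<rho> = s"
    using s \<rho> by (simp_all add: \<gamma>_def)
  \<comment> \<open>Compare \<open>x\<close> with the point of the ball farthest in the gradient direction: convexity forces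
    equality in the Cauchy-Schwarz inequality for the gradient and \<open>x - x0\<close>.\<close>
  have GD: "\<rho> * s \<le> ip G D"
  proof (cases "s = 0")
    case True
    then have "(\<Sum>u\<in>U. G u * G u) = 0"
      using s by (simp add: ip_def)
    then have "\<forall>u\<in>U. G u * G u = 0"
      using fin by (subst (asm) sum_nonneg_eq_0_iff) auto
    then show ?thesis using True by (simp add: ip_def)
  next
    case False
    define z where "z u = \<rho> / s * G u - D u" for u
    have "ip (\<lambda>u. D u + 1 * z u) (\<lambda>u. D u + 1 * z u) = (\<rho> / s)\<^sup>2 * ip G G"
      by (simp add: ip_def z_def power2_eq_square sum_distrib_left algebra_simps)
    also have "\<dots> = \<rho>\<^sup>2"
      using False s(2) by (simp add: power_divide flip: s(2))
    finally have "2 * 1 * ip G z + 1\<^sup>2 * q z \<le> 0"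
      unfolding ip_add by (intro max') simp
    then have "ip G z \<le> 0"
      using q0 [of z] by simp
    moreover have "ip G z = \<rho> / s * ip G G - ip G D"
      by (simp add: ip_def z_def algebra_simps sum_subtractf sum_distrib_left)
    moreover have "\<rho> / s * ip G G = \<rho> * s"
      using False by (simp add: power2_eq_square flip: s(2))
    ultimately show ?thesis by simp
  qed
  have "ip (\<lambda>u. G u + (- \<gamma>) * D u) (\<lambda>u. G u + (- \<gamma>) * D u) = s\<^sup>2 - 2 * \<gamma> * ip G D + \<gamma>\<^sup>2 * ip D D"
    unfolding ip_add by (simp add: s)
  also have "\<dots> \<le> s\<^sup>2 - 2 * \<gamma> * (\<rho> * s) + \<gamma>\<^sup>2 * \<rho>\<^sup>2"
    using GD ball' \<gamma> by (intro add_mono diff_mono mult_left_mono) auto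
  also have "\<dots> = 0"
    using \<gamma>(2) by (simp add: algebra_simps power2_eq_square)
  finally have "ip (\<lambda>u. G u + (- \<gamma>) * D u) (\<lambda>u. G u + (- \<gamma>) * D u) = 0"
    using ip0 by (simp add: antisym)
  then have stat: "G u = \<gamma> * D u" if "u \<in> U" for u
    unfolding ip_def using fin that by (subst (asm) sum_nonneg_eq_0_iff) auto
  then have GDy: "ip G y = \<gamma> * ip D y" for y
    by (simp add: ip_def sum_distrib_left mult.assoc)
  have slack: "\<gamma> * ip D D = \<gamma> * \<rho>\<^sup>2"
  proof -
    have "\<gamma> * \<rho>\<^sup>2 \<le> \<gamma> * ip D D"
      using GD unfolding GDy \<gamma>(2) [symmetric] by (simp add: power2_eq_square mult_ac)
    moreover have "\<gamma> * ip D D \<le> \<gamma> * \<rho>\<^sup>2"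
      using ball' \<gamma>(1) by (rule mult_left_mono)
    ultimately show ?thesis by (rule antisym [rotated])
  qed
  have psd: "q y \<le> \<gamma> * ip y y" for y
  proof (cases "\<gamma> = 0")
    case True
    then have "B x z = 0" for z
      using GDy [of z] by (simp add: adj)
    then have qx: "q x = 0" by (simp add: q)
    \<comment> \<open>Scaling that keeps \<open>x0 + t * y\<close> in the ball, where
      \<open>q\<close> is already known to vanish; the \<open>+ 1\<close> avoids a division by
      zero.\<close>
    define t where "t = \<rho> / (sqrt (ip y y) + 1)"
    have r: "0 < sqrt (ip y y) + 1"
      using ip0 [of y] by (simp add: add_nonneg_pos)
    have t: "0 < t" using \<rho> r by (simp add: t_def)
    have "t\<^sup>2 * ip y y = \<rho>\<^sup>2 * ((sqrt (ip y y))\<^sup>2 / (sqrt (ip y y) + 1)\<^sup>2)"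
      using ip0 [of y] by (simp add: t_def power_divide)
    also have "\<dots> \<le> \<rho>\<^sup>2 * 1"
    proof (rule mult_left_mono)
      have "(sqrt (ip y y))\<^sup>2 \<le> (sqrt (ip y y) + 1)\<^sup>2"
        using ip0 [of y] by (intro power_mono) auto
      then show "(sqrt (ip y y))\<^sup>2 / (sqrt (ip y y) + 1)\<^sup>2 \<le> 1"
        using r by (subst divide_le_eq_1_pos) auto
    qed simp
    finally have "(\<Sum>u\<in>U. (x0 u + t * y u - x0 u)\<^sup>2) \<le> \<rho>\<^sup>2"
      by (simp add: ip_def power2_eq_square sum_distrib_left mult_ac)
    then have 1: "q (\<lambda>u. x0 u + t * y u) \<le> 0"
      using max qx by metis
    have "q x0 \<le> 0"
      using max [of x0] qx \<rho> by simp
    then have "q x0 = 0"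
      using q0 [of x0] by linarith
    then have "(\<Sum>v\<in>V. (E v x0)\<^sup>2) = 0"
      by (simp add: q_def E_def)
    then have "\<forall>v\<in>V. (E v x0)\<^sup>2 = 0"
      using fin by (subst (asm) sum_nonneg_eq_0_iff) auto
    then have "B x0 y = 0" by (simp add: B_def)
    with 1 q0 [of x0] have "t\<^sup>2 * q y \<le> 0"
      unfolding q_add by simp
    then show ?thesis
      using t True by (simp add: mult_le_0_iff)
  next
    case False
    then have DD: "ip D D = \<rho>\<^sup>2"
      using slack by simp
    have main: "q y \<le> \<gamma> * ip y y" if "ip D y \<noteq> 0" for y
    proof -
      have "ip y y \<noteq> 0"
      proof
        assume "ip y y = 0"
        then have "\<forall>u\<in>U. y u * y u = 0"
          unfolding ip_def using fin by (subst (asm) sum_nonneg_eq_0_iff) auto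
        then show False using that by (simp add: ip_def)
      qed
      \<comment> \<open>Chosen so that \<open>x + a * y\<close> is the second point where the line
        through \<open>x\<close> in direction \<open>y\<close> meets the sphere; it differs from
        \<open>x\<close> because \<open>ip D y \<noteq> 0\<close>.\<close>
      define a where "a = - 2 * ip D y / ip y y"
      have a: "a * ip y y = - 2 * ip D y" "a \<noteq> 0"
        using \<open>ip y y \<noteq> 0\<close> that by (simp_all add: a_def)
      have "2 * a * ip D y + a\<^sup>2 * ip y y = 0"
        using a(1) by (simp add: power2_eq_square mult.assoc)
      then have "2 * a * ip G y + a\<^sup>2 * q y \<le> 0"
        using DD by (intro max') simp
      moreover have "2 * a * ip G y = - (\<gamma> * (a\<^sup>2 * ip y y))"
        using \<open>2 * a * ip D y + a\<^sup>2 * ip y y = 0\<close> unfolding GDy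
        by (metis (no_types, lifting) add_eq_0_iff2 mult.left_commute mult_minus_right)
      ultimately have "a\<^sup>2 * q y \<le> a\<^sup>2 * (\<gamma> * ip y y)"
        by (simp add: mult_ac)
      then show ?thesis using a(2) by simp
    qed
    show ?thesis
    proof (cases "ip D y = 0")
      case True
      have Dy: "ip y D = 0"
        using True by (simp add: ip_def mult.commute)
      \<comment> \<open>A tangent line has no second intersection point. Tilting \<open>y\<close> by
        \<open>t n * D\<close> makes \<open>main\<close> applicable, and the bound survives the
        limit.\<close>
      define t where "t n = 1 / real (Suc n)" for n
      have t0: "t \<longlonglongrightarrow> 0"
        unfolding t_def using LIMSEQ_inverse_real_of_nat by (simp add: inverse_eq_divide)
      have "q y + 2 * t n * B y D + (t n)\<^sup>2 * q D \<le> \<gamma> * (ip y y + 2 * t n * 0 + (t n)\<^sup>2 * ip D D)" for n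
      proof -
        have "ip D (\<lambda>u. y u + t n * D u) = ip D y + t n * ip D D"
          by (simp add: ip_def algebra_simps sum.distrib sum_distrib_left)
        then have "ip D (\<lambda>u. y u + t n * D u) \<noteq> 0"
          using True DD \<rho> by (simp add: t_def)
        from main [OF this] show ?thesis
          unfolding q_add ip_add Dy .
      qed
      moreover have "(\<lambda>n. q y + 2 * t n * B y D + (t n)\<^sup>2 * q D) \<longlonglongrightarrow> q y + 2 * 0 * B y D + 0\<^sup>2 * q D"
        by (intro tendsto_intros t0)
      moreover have "(\<lambda>n. \<gamma> * (ip y y + 2 * t n * 0 + (t n)\<^sup>2 * ip D D)) \<longlonglongrightarrow> \<gamma> * (ip y y + 2 * 0 * 0 + 0\<^sup>2 * ip D D)"
        by (intro tendsto_intros t0)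
      ultimately have "q y + 2 * 0 * B y D + 0\<^sup>2 * q D \<le> \<gamma> * (ip y y + 2 * 0 * 0 + 0\<^sup>2 * ip D D)"
        by (intro LIMSEQ_le) auto
      then show ?thesis by simp
    qed (rule main)
  qed
  show ?thesis
    by (rule that [of \<gamma>])
      (use \<gamma> stat psd slack in \<open>simp_all add: G_def E_def D_def ip_def power2_eq_square\<close>)
qed

lemma trust_region_multiplier_matrix:
  fixes E G G0 :: "nat \<Rightarrow> nat \<Rightarrow> real" and R n m :: nat
  defines "F \<equiv> \<lambda>X. \<Sum>r<R. \<Sum>j<m. (\<Sum>i<n. E r i * X i j)\<^sup>2"
  assumes m: "0 < m" and \<rho>: "0 < \<rho>"
    and ball: "(\<Sum>i<n. \<Sum>j<m. (G i j - G0 i j)\<^sup>2) \<le> \<rho>\<^sup>2"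
    and max: "\<And>X. (\<Sum>i<n. \<Sum>j<m. (X i j - G0 i j)\<^sup>2) \<le> \<rho>\<^sup>2 \<Longrightarrow> F X \<le> F G"
  obtains \<gamma> where "0 \<le> \<gamma>"
    "\<And>i j. i < n \<Longrightarrow> j < m \<Longrightarrow> (\<Sum>r<R. E r i * (\<Sum>k<n. E r k * G k j)) = \<gamma> * (G i j - G0 i j)"
    "\<And>x. (\<Sum>r<R. (\<Sum>i<n. E r i * x i)\<^sup>2) \<le> \<gamma> * (\<Sum>i<n. (x i)\<^sup>2)"
    "\<gamma> * (\<Sum>i<n. \<Sum>j<m. (G i j - G0 i j)\<^sup>2) = \<gamma> * \<rho>\<^sup>2"
proof -
  define U where "U = {..<n} \<times> {..<m}"
  define V where "V = {..<R} \<times> {..<m}"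
  \<comment> \<open>Kronecker product of \<open>E\<close> with the identity on columns: the matrix
    problem in vectorised form. The bound for a single vector \<open>x\<close> is later read off
    from the matrix whose only nonzero column is \<open>x\<close>.\<close>
  define e where "e v u = (if snd v = snd u then E (fst v) (fst u) else 0)" for v u :: "nat \<times> nat"
  have sumU: "(\<Sum>u\<in>U. f u) = (\<Sum>i<n. \<Sum>j<m. f (i, j))" for f :: "nat \<times> nat \<Rightarrow> real"
    by (simp add: U_def sum.cartesian_product)
  have sumV: "(\<Sum>u\<in>V. f u) = (\<Sum>i<R. \<Sum>j<m. f (i, j))" for f :: "nat \<times> nat \<Rightarrow> real"
    by (simp add: V_def sum.cartesian_product)
  have ey: "(\<Sum>u\<in>U. e (r, j) u * y u) = (\<Sum>i<n. E r i * y (i, j))" if "j < m" for r j y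
    using that by (simp add: sumU e_def if_distrib [of "\<lambda>x. x * _"] sum.delta cong: if_cong)
  have q: "(\<Sum>v\<in>V. (\<Sum>u\<in>U. e v u * y u)\<^sup>2) = F (\<lambda>i j. y (i, j))" for y
    by (simp add: sumV ey F_def)
  obtain \<gamma> where \<gamma>: "0 \<le> \<gamma>"
    "\<And>u. u \<in> U \<Longrightarrow> (\<Sum>v\<in>V. e v u * (\<Sum>w\<in>U. e v w * case_prod G w)) = \<gamma> * (case_prod G u - case_prod G0 u)"
    "\<And>y. (\<Sum>v\<in>V. (\<Sum>u\<in>U. e v u * y u)\<^sup>2) \<le> \<gamma> * (\<Sum>u\<in>U. (y u)\<^sup>2)"
    "\<gamma> * (\<Sum>u\<in>U. (case_prod G u - case_prod G0 u)\<^sup>2) = \<gamma> * \<rho>\<^sup>2"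
  proof (rule trust_region_multiplier [of U V \<rho> "case_prod G" "case_prod G0" e])
    show "finite U" "finite V" by (simp_all add: U_def V_def)
    show "(\<Sum>u\<in>U. (case_prod G u - case_prod G0 u)\<^sup>2) \<le> \<rho>\<^sup>2"
      using ball by (simp add: sumU)
    show "(\<Sum>v\<in>V. (\<Sum>u\<in>U. e v u * y u)\<^sup>2) \<le> (\<Sum>v\<in>V. (\<Sum>u\<in>U. e v u * case_prod G u)\<^sup>2)"
      if "(\<Sum>u\<in>U. (y u - case_prod G0 u)\<^sup>2) \<le> \<rho>\<^sup>2" for y
      unfolding q using max [of "\<lambda>i j. y (i, j)"] that by (simp add: sumU)
  qed (use \<rho> in auto)
  show ?thesis
  proof (rule that [of \<gamma>])
    fix i j assume ij: "i < n" "j < m"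
    have "(\<Sum>v\<in>V. e v (i, j) * (\<Sum>w\<in>U. e v w * case_prod G w)) = (\<Sum>r<R. E r i * (\<Sum>k<n. E r k * G k j))"
      using ij by (simp add: sumV ey) (simp add: e_def if_distrib [of "\<lambda>x. x * _"] sum.delta cong: if_cong)
    then show "(\<Sum>r<R. E r i * (\<Sum>k<n. E r k * G k j)) = \<gamma> * (G i j - G0 i j)"
      using \<gamma>(2) [of "(i, j)"] ij by (simp add: U_def)
  next
    fix x :: "nat \<Rightarrow> real"
    have "F (\<lambda>i j. if j = 0 then x i else 0) = (\<Sum>r<R. (\<Sum>i<n. E r i * x i)\<^sup>2)"
      unfolding F_def
    proof (rule sum.cong [OF refl])
      fix r
      have "(\<Sum>j<m. (\<Sum>i<n. E r i * (if j = 0 then x i else 0))\<^sup>2)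
          = (\<Sum>j\<in>{0::nat}. (\<Sum>i<n. E r i * (if j = 0 then x i else 0))\<^sup>2)"
        using m by (intro sum.mono_neutral_right) auto
      then show "(\<Sum>j<m. (\<Sum>i<n. E r i * (if j = 0 then x i else 0))\<^sup>2) = (\<Sum>i<n. E r i * x i)\<^sup>2"
        by simp
    qed
    moreover have "(\<Sum>j<m. (if j = 0 then x i else 0)\<^sup>2) = (x i)\<^sup>2" for i
      using m by (simp add: if_distrib [of "\<lambda>x. x\<^sup>2"] sum.delta cong: if_cong)
    ultimately show "(\<Sum>r<R. (\<Sum>i<n. E r i * x i)\<^sup>2) \<le> \<gamma> * (\<Sum>i<n. (x i)\<^sup>2)"
      using \<gamma>(3) [of "\<lambda>(i, j). if j = 0 then x i else 0"] unfolding q by (simp add: sumU)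
  qed (use \<gamma> in \<open>simp_all add: sumU\<close>)
qed

lemma nn_integral_sum_lin_square:
  "(\<integral>\<^sup>+z. ennreal (\<Sum>r<R. (\<Sum>j<m. a r j * z j)\<^sup>2) \<partial>std_normal_vec {..<m})
    = ennreal (\<Sum>r<R. \<Sum>j<m. (a r j)\<^sup>2)"
proof -
  have "(\<integral>\<^sup>+z. ennreal (\<Sum>r<R. (\<Sum>j<m. a r j * z j)\<^sup>2) \<partial>std_normal_vec {..<m})
     = (\<integral>\<^sup>+z. (\<Sum>r<R. ennreal ((\<Sum>j<m. a r j * z j)\<^sup>2)) \<partial>std_normal_vec {..<m})"
    by (simp add: sum_ennreal)
  also have "\<dots> = (\<Sum>r<R. (\<integral>\<^sup>+z. ennreal ((\<Sum>j<m. a r j * z j)\<^sup>2) \<partial>std_normal_vec {..<m}))"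
    by (rule nn_integral_sum) measurable
  also have "\<dots> = (\<Sum>r<R. ennreal (\<Sum>j<m. (a r j)\<^sup>2))"
    by (simp only: nn_integral_std_normal_vec_lin_square)
  also have "\<dots> = ennreal (\<Sum>r<R. \<Sum>j<m. (a r j)\<^sup>2)"
    by (simp add: sum_ennreal sum_nonneg)
  finally show ?thesis .
qed

lemma measurable_Rn_component: "i < n \<Longrightarrow> (\<lambda>x. x i) \<in> borel_measurable (Rn n)"
  unfolding Rn_def by (intro measurable_component_singleton) auto

lemma real_limit_of_rationals: "\<exists>w. w \<longlonglongrightarrow> (x::real) \<and> (\<forall>k. w k \<in> \<rat>)"
proof -
  have "\<exists>r\<in>\<rat>. x < r \<and> r < x + 1 / real (Suc k)" for k
    by (intro Rats_dense_in_real) simp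
  then obtain w where w: "\<And>k. w k \<in> \<rat>" "\<And>k. x < w k" "\<And>k. w k < x + 1 / real (Suc k)"
    by metis
  have lim: "(\<lambda>k. x + 1 / real (Suc k)) \<longlonglongrightarrow> x"
    using LIMSEQ_inverse_real_of_nat_add [of x] by (simp add: inverse_eq_divide)
  have "w \<longlonglongrightarrow> x"
    by (rule tendsto_sandwich [OF _ _ tendsto_const [of x] lim])
      (intro always_eventually allI less_imp_le w)+
  with w show ?thesis by blast
qed

text \<open>Lagrangian duality: for the multiplier \<open>\<gamma>\<close> of the trust region problem, \<open>|E x|\<^sup>2 - \<gamma> |x - y|\<^sup>2\<close>
  is maximal over \<open>x\<close> at \<open>x = G z\<close> when \<open>y = G0 z\<close>. The supremum over \<open>x\<close> is taken over rational
  points to keep it measurable in \<open>y\<close>.\<close>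
theorem wasserstein_ball_second_moment_le:
  fixes E G G0 :: "nat \<Rightarrow> nat \<Rightarrow> real" and R n m :: nat
  defines "F \<equiv> \<lambda>X. \<Sum>r<R. \<Sum>j<m. (\<Sum>i<n. E r i * X i j)\<^sup>2"
  assumes m: "0 < m" and \<rho>: "0 < \<rho>"
    and ball: "(\<Sum>i<n. \<Sum>j<m. (G i j - G0 i j)\<^sup>2) \<le> \<rho>\<^sup>2"
    and max: "\<And>X. (\<Sum>i<n. \<Sum>j<m. (X i j - G0 i j)\<^sup>2) \<le> \<rho>\<^sup>2 \<Longrightarrow> F X \<le> F G"
    and P: "P \<in> wball n (gauss_law n m G0) \<rho>"
  shows "(\<integral>\<^sup>+x. ennreal (\<Sum>r<R. (\<Sum>i<n. E r i * x i)\<^sup>2) \<partial>P) \<le> ennreal (F G)"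
proof -
  obtain \<gamma> where \<gamma>: "0 \<le> \<gamma>"
    and stat: "\<And>i j. i < n \<Longrightarrow> j < m \<Longrightarrow> (\<Sum>r<R. E r i * (\<Sum>k<n. E r k * G k j)) = \<gamma> * (G i j - G0 i j)"
    and psd: "\<And>x. (\<Sum>r<R. (\<Sum>i<n. E r i * x i)\<^sup>2) \<le> \<gamma> * (\<Sum>i<n. (x i)\<^sup>2)"
    and slack: "\<gamma> * (\<Sum>i<n. \<Sum>j<m. (G i j - G0 i j)\<^sup>2) = \<gamma> * \<rho>\<^sup>2"
    using trust_region_multiplier_matrix [OF m \<rho> ball max [unfolded F_def]] by blast
  note [measurable] = measurable_Rn_component
  define q where "q x = (\<Sum>r<R. (\<Sum>i<n. E r i * x i)\<^sup>2)" for x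
  define h where "h x y = q x - \<gamma> * sqnorm n (\<lambda>i. x i - y i)" for x y
  define D where "D = PiE {..<n} (\<lambda>_. \<rat> :: real set)"
  define \<Psi> where "\<Psi> y = (SUP x\<in>D. ennreal (h x y))" for y
  define lin where "lin X z = (\<lambda>i\<in>{..<n}. \<Sum>j<m. X i j * z j)" for X :: "nat \<Rightarrow> nat \<Rightarrow> real" and z
  define A where "A z = h (lin G z) (lin G0 z)" for z
  have q0: "0 \<le> q x" for x
    by (simp add: q_def sum_nonneg)
  have D: "countable D"
    unfolding D_def by (intro countable_PiE) (auto simp: countable_rat)
  have [measurable]: "q \<in> borel_measurable (Rn n)"
    unfolding q_def [abs_def] by measurable
  have [measurable]: "(\<lambda>y. ennreal (h x y)) \<in> borel_measurable (Rn n)" for x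
    unfolding h_def sqnorm_def by measurable
  have \<Psi>_meas: "\<Psi> \<in> borel_measurable (Rn n)"
    unfolding \<Psi>_def [abs_def] using D by (rule borel_measurable_SUP) measurable
  have h_le: "ennreal (h x y) \<le> \<Psi> y" for x y
  proof -
    have "\<forall>i. \<exists>w. w \<longlonglongrightarrow> x i \<and> (\<forall>k. w k \<in> \<rat>)"
      using real_limit_of_rationals by blast
    from choice [OF this] obtain w where w: "\<And>i. w i \<longlonglongrightarrow> x i" "\<And>i k. w i k \<in> \<rat>"
      by blast
    define u where "u k = (\<lambda>i\<in>{..<n}. w i k)" for k
    have u: "u k \<in> D" for k
      by (auto simp: u_def D_def w)
    have "(\<lambda>k. (\<Sum>r<R. (\<Sum>i<n. E r i * w i k)\<^sup>2) - \<gamma> * (\<Sum>i<n. (w i k - y i)\<^sup>2))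
       \<longlonglongrightarrow> (\<Sum>r<R. (\<Sum>i<n. E r i * x i)\<^sup>2) - \<gamma> * (\<Sum>i<n. (x i - y i)\<^sup>2)"
      by (intro tendsto_intros w)
    then have "(\<lambda>k. h (u k) y) \<longlonglongrightarrow> h x y"
      by (simp add: h_def q_def sqnorm_def u_def)
    then have "(\<lambda>k. ennreal (h (u k) y)) \<longlonglongrightarrow> ennreal (h x y)"
      by (rule tendsto_ennrealI)
    then show ?thesis
      by (rule LIMSEQ_le_const2) (auto simp: \<Psi>_def intro!: SUP_upper u)
  qed
  \<comment> \<open>Expansion around \<open>X = G z\<close>: the linear term vanishes by
    \<open>stat\<close>, and the remainder \<open>q d - \<gamma> * |d|^2\<close> is nonpositive by
    \<open>psd\<close>.\<close>
  have A_max: "h x (lin G0 z) \<le> A z" for x z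
  proof -
    define X where "X i = (\<Sum>j<m. G i j * z j)" for i
    define Y where "Y i = (\<Sum>j<m. G0 i j * z j)" for i
    define d where "d i = x i - X i" for i
    have "(\<Sum>r<R. E r i * (\<Sum>k<n. E r k * X k)) = \<gamma> * (X i - Y i)" if i: "i < n" for i
    proof -
      have "(\<Sum>k<n. E r k * X k) = (\<Sum>j<m. (\<Sum>k<n. E r k * G k j) * z j)" for r
        unfolding X_def sum_distrib_left sum_distrib_right
        by (subst sum.swap) (simp add: mult.assoc)
      then have "(\<Sum>r<R. E r i * (\<Sum>k<n. E r k * X k)) = (\<Sum>r<R. \<Sum>j<m. E r i * ((\<Sum>k<n. E r k * G k j) * z j))"
        by (simp only: sum_distrib_left)
      also have "\<dots> = (\<Sum>j<m. (\<Sum>r<R. E r i * (\<Sum>k<n. E r k * G k j)) * z j)"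
        by (subst sum.swap) (simp only: sum_distrib_right mult.assoc)
      also have "\<dots> = (\<Sum>j<m. \<gamma> * (G i j - G0 i j) * z j)"
        using stat i by (intro sum.cong) auto
      also have "\<dots> = \<gamma> * (X i - Y i)"
        by (simp add: X_def Y_def algebra_simps sum_subtractf sum_distrib_left)
      finally show ?thesis .
    qed
    then have "(\<Sum>i<n. (\<Sum>r<R. E r i * (\<Sum>k<n. E r k * X k)) * d i) = (\<Sum>i<n. \<gamma> * (X i - Y i) * d i)"
      by (intro sum.cong) auto
    moreover have "(\<Sum>i<n. (\<Sum>r<R. E r i * e r) * d i) = (\<Sum>r<R. e r * (\<Sum>i<n. E r i * d i))" for e
      unfolding sum_distrib_right sum_distrib_left by (subst sum.swap) (simp add: mult_ac)
    ultimately have cross: "(\<Sum>r<R. (\<Sum>k<n. E r k * X k) * (\<Sum>i<n. E r i * d i)) = (\<Sum>i<n. \<gamma> * (X i - Y i) * d i)"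
      by metis
    have split: "(\<Sum>i<n. E r i * x i) = (\<Sum>i<n. E r i * X i) + (\<Sum>i<n. E r i * d i)" for r
      by (simp add: d_def right_diff_distrib sum_subtractf)
    have sq: "(\<Sum>r<R. (a r + b r)\<^sup>2) = (\<Sum>r<R. (a r)\<^sup>2) + 2 * (\<Sum>r<R. a r * b r) + (\<Sum>r<R. (b r)\<^sup>2)"
      for a b :: "nat \<Rightarrow> real"
      by (simp add: power2_sum sum.distrib sum_distrib_left mult_ac)
    have qx: "q x = q X + 2 * (\<Sum>r<R. (\<Sum>k<n. E r k * X k) * (\<Sum>i<n. E r i * d i)) + q d"
      unfolding q_def split sq ..
    have nx: "sqnorm n (\<lambda>i. x i - Y i) = sqnorm n (\<lambda>i. X i - Y i) + 2 * (\<Sum>i<n. (X i - Y i) * d i) + (\<Sum>i<n. (d i)\<^sup>2)"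
      by (simp add: sqnorm_def d_def power2_eq_square algebra_simps sum.distrib sum_distrib_left sum_subtractf)
    have "h x Y \<le> h X Y"
      unfolding h_def qx nx cross using psd [of d]
      by (simp add: q_def algebra_simps sum_distrib_left)
    moreover have "h X Y = A z" "h x Y = h x (lin G0 z)"
      by (simp_all add: A_def h_def q_def sqnorm_def lin_def X_def Y_def)
    ultimately show ?thesis by simp
  qed
  \<comment> \<open>Testing with \<open>x = y\<close> shows that \<open>ennreal\<close> truncates
    nothing in \<open>A\<close>, so its integral can be split additively.\<close>
  have A0: "0 \<le> A z" for z
    using A_max [of "lin G0 z" z] q0 [of "lin G0 z"] by (simp add: h_def sqnorm_def)
  \<comment> \<open>Absence of a duality gap: complementary slackness \<open>slack\<close> turns the
    mean penalty under the joint drive by \<open>z\<close> into exactly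
    \<open>\<gamma> * \<rho>\<^sup>2\<close>.\<close>
  have intA: "(\<integral>\<^sup>+z. ennreal (A z) \<partial>std_normal_vec {..<m}) + ennreal (\<gamma> * \<rho>\<^sup>2) = ennreal (F G)"
  proof -
    have [measurable]: "lin X \<in> measurable (std_normal_vec {..<m}) (Rn n)" for X
      unfolding lin_def [abs_def] by measurable
    have [measurable]: "(\<lambda>z. lin X z i) \<in> borel_measurable (std_normal_vec {..<m})" if "i < n" for X i
      using that by measurable
    have [measurable]: "A \<in> borel_measurable (std_normal_vec {..<m})"
      unfolding A_def [abs_def] h_def sqnorm_def by measurable
    have l: "lin X z i = (\<Sum>j<m. X i j * z j)" if "i < n" for X z i
      using that by (simp add: lin_def)
    have "(\<integral>\<^sup>+z. ennreal (sqnorm n (\<lambda>i. lin G z i - lin G0 z i)) \<partial>std_normal_vec {..<m})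
       = (\<integral>\<^sup>+z. ennreal (\<Sum>i<n. (\<Sum>j<m. (G i j - G0 i j) * z j)\<^sup>2) \<partial>std_normal_vec {..<m})"
      by (simp add: sqnorm_def l algebra_simps sum_subtractf)
    also have "\<dots> = ennreal (\<Sum>i<n. \<Sum>j<m. (G i j - G0 i j)\<^sup>2)"
      by (rule nn_integral_sum_lin_square)
    finally have c: "(\<integral>\<^sup>+z. ennreal (\<gamma> * sqnorm n (\<lambda>i. lin G z i - lin G0 z i)) \<partial>std_normal_vec {..<m})
       = ennreal (\<gamma> * \<rho>\<^sup>2)"
      unfolding slack [symmetric] using \<gamma>
      by (simp add: ennreal_mult' nn_integral_cmult sqnorm_def)
    have "q (lin G z) = (\<Sum>r<R. (\<Sum>j<m. (\<Sum>i<n. E r i * G i j) * z j)\<^sup>2)" for z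
    proof -
      have "(\<Sum>i<n. E r i * lin G z i) = (\<Sum>j<m. (\<Sum>i<n. E r i * G i j) * z j)" for r
        by (simp add: l sum_distrib_left sum_distrib_right) (subst sum.swap, simp add: mult.assoc)
      then show ?thesis by (simp add: q_def)
    qed
    then have "(\<integral>\<^sup>+z. ennreal (q (lin G z)) \<partial>std_normal_vec {..<m}) = ennreal (F G)"
      using nn_integral_sum_lin_square [where R = R and m = m and a = "\<lambda>r j. \<Sum>i<n. E r i * G i j"] by (simp add: F_def)
    also have "(\<integral>\<^sup>+z. ennreal (q (lin G z)) \<partial>std_normal_vec {..<m})
       = (\<integral>\<^sup>+z. ennreal (A z) + ennreal (\<gamma> * sqnorm n (\<lambda>i. lin G z i - lin G0 z i)) \<partial>std_normal_vec {..<m})"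
    proof (rule nn_integral_cong)
      fix z
      have "q (lin G z) = A z + \<gamma> * sqnorm n (\<lambda>i. lin G z i - lin G0 z i)"
        by (simp add: A_def h_def)
      then show "ennreal (q (lin G z)) = ennreal (A z) + ennreal (\<gamma> * sqnorm n (\<lambda>i. lin G z i - lin G0 z i))"
        using A0 \<gamma> by (simp add: ennreal_plus sqnorm_def sum_nonneg)
    qed
    also have "\<dots> = (\<integral>\<^sup>+z. ennreal (A z) \<partial>std_normal_vec {..<m}) + ennreal (\<gamma> * \<rho>\<^sup>2)"
      unfolding c [symmetric] by (rule nn_integral_add) (unfold sqnorm_def, measurable)
    finally show ?thesis .
  qed
  have int\<Psi>: "(\<integral>\<^sup>+y. \<Psi> y \<partial>gauss_law n m G0) \<le> (\<integral>\<^sup>+z. ennreal (A z) \<partial>std_normal_vec {..<m})"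
  proof -
    have "(\<integral>\<^sup>+y. \<Psi> y \<partial>gauss_law n m G0) = (\<integral>\<^sup>+z. \<Psi> (lin G0 z) \<partial>std_normal_vec {..<m})"
      unfolding nn_integral_gauss_law [OF \<Psi>_meas] lin_def ..
    also have "\<dots> \<le> (\<integral>\<^sup>+z. ennreal (A z) \<partial>std_normal_vec {..<m})"
      by (intro nn_integral_mono) (auto simp: \<Psi>_def intro!: SUP_least ennreal_leI A_max)
    finally show ?thesis .
  qed
  have coupl: "(\<integral>\<^sup>+x. ennreal (q x) \<partial>P) \<le> ennreal \<gamma> * (\<integral>\<^sup>+w. ennreal (sqnorm n (\<lambda>i. fst w i - snd w i)) \<partial>\<mu>)
      + (\<integral>\<^sup>+y. \<Psi> y \<partial>gauss_law n m G0)" if \<mu>: "\<mu> \<in> couplings n P (gauss_law n m G0)" for \<mu>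
  proof -
    have [measurable_cong]: "sets \<mu> = sets (Rn n \<Otimes>\<^sub>M Rn n)"
      using \<mu> by (simp add: couplings_def)
    have P': "P = distr \<mu> (Rn n) fst" and P0: "gauss_law n m G0 = distr \<mu> (Rn n) snd"
      using \<mu> by (auto simp: couplings_def)
    have [measurable]: "(\<lambda>w. sqnorm n (\<lambda>i. fst w i - snd w i)) \<in> borel_measurable \<mu>"
      unfolding sqnorm_def by measurable
    have [measurable]: "(\<lambda>w. \<Psi> (snd w)) \<in> borel_measurable \<mu>"
      using \<Psi>_meas by measurable
    have "(\<integral>\<^sup>+x. ennreal (q x) \<partial>P) = (\<integral>\<^sup>+w. ennreal (q (fst w)) \<partial>\<mu>)"
      unfolding P' by (rule nn_integral_distr) measurable
    also have "\<dots> \<le> (\<integral>\<^sup>+w. ennreal \<gamma> * ennreal (sqnorm n (\<lambda>i. fst w i - snd w i)) + \<Psi> (snd w) \<partial>\<mu>)"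
    proof (rule nn_integral_mono)
      fix w :: "(nat \<Rightarrow> real) \<times> (nat \<Rightarrow> real)"
      let ?b = "\<gamma> * sqnorm n (\<lambda>i. fst w i - snd w i)"
      have b: "0 \<le> ?b"
        using \<gamma> by (simp add: sqnorm_def sum_nonneg)
      \<comment> \<open>Where \<open>h\<close> is negative, \<open>ennreal\<close> truncates it to
        0, and the penalty alone dominates \<open>q\<close>.\<close>
      have "ennreal (q (fst w)) \<le> ennreal ?b + ennreal (h (fst w) (snd w))"
      proof (cases "0 \<le> h (fst w) (snd w)")
        case True
        then show ?thesis
          using b by (simp add: h_def flip: ennreal_plus)
      next
        case False
        then have "ennreal (q (fst w)) \<le> ennreal ?b"
          by (intro ennreal_leI) (simp add: h_def)
        then show ?thesis by (simp add: add_increasing2)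
      qed
      also have "\<dots> \<le> ennreal ?b + \<Psi> (snd w)"
        by (intro add_left_mono h_le)
      finally show "ennreal (q (fst w)) \<le> ennreal \<gamma> * ennreal (sqnorm n (\<lambda>i. fst w i - snd w i)) + \<Psi> (snd w)"
        using \<gamma> by (simp add: ennreal_mult')
    qed
    also have "\<dots> = ennreal \<gamma> * (\<integral>\<^sup>+w. ennreal (sqnorm n (\<lambda>i. fst w i - snd w i)) \<partial>\<mu>) + (\<integral>\<^sup>+w. \<Psi> (snd w) \<partial>\<mu>)"
      by (simp add: nn_integral_add nn_integral_cmult)
    also have "(\<integral>\<^sup>+w. \<Psi> (snd w) \<partial>\<mu>) = (\<integral>\<^sup>+y. \<Psi> y \<partial>gauss_law n m G0)"
      unfolding P0 by (rule nn_integral_distr [symmetric]) (use \<Psi>_meas in measurable)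
    finally show ?thesis .
  qed
  have "(\<integral>\<^sup>+x. ennreal (q x) \<partial>P) \<le> ennreal (F G)"
  proof (rule ennreal_le_epsilon)
    fix \<epsilon> :: real assume \<epsilon>: "0 < \<epsilon>"
    define \<delta> where "\<delta> = \<epsilon> / (\<gamma> + 1)"
    have \<delta>: "0 < \<delta>" "\<gamma> * \<delta> \<le> \<epsilon>"
      using \<epsilon> \<gamma> by (auto simp: \<delta>_def field_simps)
    have "W2_sq n P (gauss_law n m G0) \<le> ennreal (\<rho>\<^sup>2)"
      using P by (simp add: wball_def)
    also have "\<dots> < ennreal (\<rho>\<^sup>2 + \<delta>)"
      using \<delta> by (intro ennreal_lessI) (auto simp: add_nonneg_pos)
    finally obtain \<mu> where \<mu>: "\<mu> \<in> couplings n P (gauss_law n m G0)"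
      "(\<integral>\<^sup>+w. ennreal (sqnorm n (\<lambda>i. fst w i - snd w i)) \<partial>\<mu>) < ennreal (\<rho>\<^sup>2 + \<delta>)"
      by (auto simp: W2_sq_def INF_less_iff)
    note coupl [OF \<mu>(1)]
    also have "ennreal \<gamma> * (\<integral>\<^sup>+w. ennreal (sqnorm n (\<lambda>i. fst w i - snd w i)) \<partial>\<mu>) + (\<integral>\<^sup>+y. \<Psi> y \<partial>gauss_law n m G0)
      \<le> ennreal \<gamma> * ennreal (\<rho>\<^sup>2 + \<delta>) + (\<integral>\<^sup>+z. ennreal (A z) \<partial>std_normal_vec {..<m})"
      using \<mu>(2) int\<Psi> by (intro add_mono mult_left_mono) auto
    also have "ennreal \<gamma> * ennreal (\<rho>\<^sup>2 + \<delta>) = ennreal (\<gamma> * \<rho>\<^sup>2) + ennreal (\<gamma> * \<delta>)"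
      using \<gamma> \<delta> by (simp add: distrib_left flip: ennreal_mult' ennreal_plus)
    also have "\<dots> + (\<integral>\<^sup>+z. ennreal (A z) \<partial>std_normal_vec {..<m}) = ennreal (F G) + ennreal (\<gamma> * \<delta>)"
      unfolding intA [symmetric] by (simp add: ac_simps)
    also have "\<dots> \<le> ennreal (F G) + ennreal \<epsilon>"
      using \<delta> by (intro add_left_mono ennreal_leI)
    finally show "(\<integral>\<^sup>+x. ennreal (q x) \<partial>P) \<le> ennreal (F G) + ennreal \<epsilon>" .
  qed
  then show ?thesis by (simp add: q_def)
qed

section \<open>The linear estimation game\<close>

text \<open>Costs and gradients of the game see \<open>X\<close> only through its Gram matrix, and
  they do so linearly; this is what lets them be mixed.\<close>

lemma gram_bilinear:
  fixes X :: "nat \<Rightarrow> nat \<Rightarrow> real"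
  shows "(\<Sum>l<m. (\<Sum>i<n. a i * X i l) * (\<Sum>i<n. b i * X i l))
    = (\<Sum>i<n. \<Sum>i'<n. a i * b i' * (\<Sum>l<m. X i l * X i' l))"
proof -
  have "(\<Sum>l<m. (\<Sum>i<n. a i * X i l) * (\<Sum>i<n. b i * X i l))
     = (\<Sum>l<m. \<Sum>i<n. \<Sum>i'<n. a i * b i' * (X i l * X i' l))"
    by (simp add: sum_product mult_ac)
  also have "\<dots> = (\<Sum>i<n. \<Sum>l<m. \<Sum>i'<n. a i * b i' * (X i l * X i' l))"
    by (rule sum.swap)
  also have "\<dots> = (\<Sum>i<n. \<Sum>i'<n. \<Sum>l<m. a i * b i' * (X i l * X i' l))"
    by (intro sum.cong refl sum.swap)
  finally show ?thesis by (simp add: sum_distrib_left)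
qed

lemma sum_add_split: "(\<Sum>l<n + k. f l) = (\<Sum>l<n. f l) + (\<Sum>l<k. f (n + l))" for f :: "nat \<Rightarrow> real"
  by (induction k) (simp_all add: add.assoc)

text \<open>The first \<open>n\<close> columns of \<open>U\<close> are averages; the remaining covariance is factored anew
  through the last \<open>n\<close> columns.\<close>
lemma gram_mix:
  fixes G G' :: "nat \<Rightarrow> nat \<Rightarrow> real"
  assumes t: "0 \<le> t" "t \<le> 1"
  obtains U where "\<And>i l. l < n \<Longrightarrow> U i l = (1 - t) * G i l + t * G' i l"
    "\<And>i i'. i < n \<Longrightarrow> i' < n \<Longrightarrow> (\<Sum>l<n + n. U i l * U i' l)
      = (1 - t) * (\<Sum>l<n + n. G i l * G i' l) + t * (\<Sum>l<n + n. G' i l * G' i' l)"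
proof -
  \<comment> \<open>With averages in the first block, the mixed Gram matrix exceeds theirs by
    \<open>t * (1 - t)\<close> times the Gram matrix of \<open>G - G'\<close> on that block, plus
    the weighted Gram matrices of the last blocks. \<open>W\<close> is a factor of this excess with
    three blocks, which \<open>gauss_law_square\<close> compresses to one.\<close>
  define W where "W i l = (if l < n then sqrt (t * (1 - t)) * (G i l - G' i l)
    else if l < n + n then sqrt (1 - t) * G i l else sqrt t * G' i (l - n))" for i l
  have "n \<le> n + n + n" by simp
  then obtain L where
    L: "\<And>i i'. i < n \<Longrightarrow> i' < n \<Longrightarrow> (\<Sum>l<n + n + n. W i l * W i' l) = (\<Sum>l<n. L i l * L i' l)"
    by (rule gauss_law_square [where G = W]) (rule that; simp)
  define U where "U i l = (if l < n then (1 - t) * G i l + t * G' i l else L i (l - n))" for i l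
  have "(\<Sum>l<n + n. U i l * U i' l)
      = (1 - t) * (\<Sum>l<n + n. G i l * G i' l) + t * (\<Sum>l<n + n. G' i l * G' i' l)"
    if i: "i < n" "i' < n" for i i'
  proof -
    have 1: "W i l * W i' l = t * (1 - t) * ((G i l - G' i l) * (G i' l - G' i' l))" if "l < n" for l
    proof -
      have "sqrt (t * (1 - t)) * sqrt (t * (1 - t)) = t * (1 - t)"
        using t by simp
      moreover have "W i l * W i' l
          = (sqrt (t * (1 - t)) * sqrt (t * (1 - t))) * ((G i l - G' i l) * (G i' l - G' i' l))"
        using that by (simp only: W_def if_True mult_ac)
      ultimately show ?thesis by simp
    qed
    have 2: "W i (n + l) * W i' (n + l) = (1 - t) * (G i (n + l) * G i' (n + l))" if "l < n" for l
      using that t by (simp add: W_def)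
    have 3: "W i (n + n + l) * W i' (n + n + l) = t * (G' i (n + l) * G' i' (n + l))" for l
      using t by (simp add: W_def)
    have "(\<Sum>l<n + n. U i l * U i' l)
       = (\<Sum>l<n. ((1 - t) * G i l + t * G' i l) * ((1 - t) * G i' l + t * G' i' l)) + (\<Sum>l<n + n + n. W i l * W i' l)"
      unfolding L [OF i] by (simp add: sum_add_split U_def)
    also have "\<dots> = (\<Sum>l<n. ((1 - t) * G i l + t * G' i l) * ((1 - t) * G i' l + t * G' i' l)
          + t * (1 - t) * ((G i l - G' i l) * (G i' l - G' i' l)))
        + (1 - t) * (\<Sum>l<n. G i (n + l) * G i' (n + l)) + t * (\<Sum>l<n. G' i (n + l) * G' i' (n + l))"
      unfolding sum_add_split by (simp add: 1 2 3 sum.distrib sum_distrib_left)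
    also have "(\<Sum>l<n. ((1 - t) * G i l + t * G' i l) * ((1 - t) * G i' l + t * G' i' l)
          + t * (1 - t) * ((G i l - G' i l) * (G i' l - G' i' l)))
        = (\<Sum>l<n. (1 - t) * (G i l * G i' l) + t * (G' i l * G' i' l))"
      by (rule sum.cong) (simp_all add: algebra_simps)
    finally show ?thesis
      by (simp add: sum_add_split sum.distrib sum_distrib_left distrib_left)
  qed
  then show ?thesis
    by (intro that [of U]) (simp add: U_def)
qed

lemma continuous_on_matrix_entry [continuous_intros]:
  "continuous_on A (\<lambda>X :: nat \<Rightarrow> nat \<Rightarrow> real. X i j)"
proof -
  have "continuous_on A (\<lambda>X :: nat \<Rightarrow> nat \<Rightarrow> real. X i)"
    by (rule continuous_on_subset [OF continuous_on_product_coordinates]) simp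
  then show ?thesis
    by (rule continuous_on_product_then_coordinatewise)
qed

text \<open>Error matrix \<open>K H - L\<close> of a linear estimator; causality is encoded by letting row \<open>r\<close> use only the
  first \<open>c r\<close> observations.\<close>
definition err :: "(nat \<Rightarrow> nat \<Rightarrow> real) \<Rightarrow> (nat \<Rightarrow> nat \<Rightarrow> real) \<Rightarrow> (nat \<Rightarrow> nat) \<Rightarrow> (nat \<times> nat \<Rightarrow> real)
    \<Rightarrow> nat \<Rightarrow> nat \<Rightarrow> real" where
  "err H L c k r i = (\<Sum>j<c r. k (r, j) * H j i) - L r i"

text \<open>The hypothesis on \<open>\<sigma>\<close> says that observation \<open>j\<close> carries its own additive noise \<open>\<sigma> j\<close>, which does not
  enter the signal; this makes the problem coercive in the estimator.\<close>
theorem linear_estimation_minimax: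
  fixes H L G0 :: "nat \<Rightarrow> nat \<Rightarrow> real" and c :: "nat \<Rightarrow> nat" and n R :: nat
  defines "F \<equiv> \<lambda>k X. \<Sum>r<R. \<Sum>l<n + n. (\<Sum>i<n. err H L c k r i * X i l)\<^sup>2"
  assumes n: "0 < n" and \<rho>: "0 < \<rho>" and G0: "\<And>i l. n \<le> l \<Longrightarrow> G0 i l = 0"
    and \<sigma>: "\<And>r j. r < R \<Longrightarrow> j < c r \<Longrightarrow> \<sigma> j < n"
      "\<And>r j j'. r < R \<Longrightarrow> j < c r \<Longrightarrow> j' < c r \<Longrightarrow> H j' (\<sigma> j) = (if j' = j then 1 else 0)"
      "\<And>r j. r < R \<Longrightarrow> j < c r \<Longrightarrow> L r (\<sigma> j) = 0"
  obtains k G where "(\<Sum>i<n. \<Sum>l<n + n. (G i l - G0 i l)\<^sup>2) \<le> \<rho>\<^sup>2"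
    "\<And>X. (\<Sum>i<n. \<Sum>l<n + n. (X i l - G0 i l)\<^sup>2) \<le> \<rho>\<^sup>2 \<Longrightarrow> F k X \<le> F k G"
    "\<And>r j. r < R \<Longrightarrow> j < c r \<Longrightarrow>
      (\<Sum>l<n + n. (\<Sum>i<n. err H L c k r i * G i l) * (\<Sum>i<n. H j i * G i l)) = 0"
proof -
  define m where "m = n + n"
  \<comment> \<open>Entries outside the stated dimensions are pinned to 0, since as free coordinates
    they would destroy compactness; \<open>mask\<close> brings an arbitrary matrix into this
    form.\<close>
  define C where "C i l = (if i < n \<and> l < m then {G0 i l - \<rho>..G0 i l + \<rho>} else {0})" for i l
  define S where "S = {X. \<forall>i. X i \<in> {x. \<forall>l. x l \<in> C i l}} \<inter> {X. (\<Sum>i<n. \<Sum>l<m. (X i l - G0 i l)\<^sup>2) \<le> \<rho>\<^sup>2}"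
  define I where "I = Sigma {..<R} (\<lambda>r. {..<c r})"
  define e where "e k X r l = (\<Sum>i<n. err H L c k r i * X i l)" for k and X :: "nat \<Rightarrow> nat \<Rightarrow> real" and r l
  define y where "y X j l = (\<Sum>i<n. H j i * X i l)" for X :: "nat \<Rightarrow> nat \<Rightarrow> real" and j l
  \<comment> \<open>Half the gradient of \<open>F\<close> in \<open>k\<close>: the correlation
    between the error of a row and an observation available to it. Its vanishing is the
    orthogonality to be shown.\<close>
  define g where "g k X v = (\<Sum>l<m. e k X (fst v) l * y X (snd v) l)" for k X v
  define h where "h d X = (\<Sum>r<R. \<Sum>l<m. (\<Sum>j<c r. d (r, j) * y X j l)\<^sup>2)" for d :: "nat \<times> nat \<Rightarrow> real" and X
  have F: "F k X = (\<Sum>r<R. \<Sum>l<m. (e k X r l)\<^sup>2)" for k X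
    by (simp add: F_def e_def m_def)
  have S: "compact S"
  proof -
    have "compact {X :: nat \<Rightarrow> nat \<Rightarrow> real. \<forall>i. X i \<in> {x. \<forall>l. x l \<in> C i l}}"
      by (intro compact_box) (simp add: C_def)
    moreover have "closed {X. (\<Sum>i<n. \<Sum>l<m. (X i l - G0 i l)\<^sup>2) \<le> \<rho>\<^sup>2}"
      by (intro closed_Collect_le continuous_intros)
    ultimately show ?thesis
      unfolding S_def by (rule compact_Int_closed)
  qed
  define mask where "mask X i l = (if i < n \<and> l < m then X i l else 0)" for X :: "nat \<Rightarrow> nat \<Rightarrow> real" and i l
  have mask: "mask X \<in> S" if X: "(\<Sum>i<n. \<Sum>l<m. (X i l - G0 i l)\<^sup>2) \<le> \<rho>\<^sup>2" for X
  proof -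
    have "mask X i l \<in> C i l" for i l
    proof (cases "i < n \<and> l < m")
      case True
      have "(X i l - G0 i l)\<^sup>2 \<le> (\<Sum>l<m. (X i l - G0 i l)\<^sup>2)"
        by (rule member_le_sum [of l "{..<m}" "\<lambda>l. (X i l - G0 i l)\<^sup>2"]) (use True in auto)
      also have "\<dots> \<le> (\<Sum>i<n. \<Sum>l<m. (X i l - G0 i l)\<^sup>2)"
        by (rule member_le_sum [of i "{..<n}" "\<lambda>i. \<Sum>l<m. (X i l - G0 i l)\<^sup>2"]) (use True in \<open>auto intro: sum_nonneg\<close>)
      also have "\<dots> \<le> \<rho>\<^sup>2" by (rule X)
      finally have "\<bar>X i l - G0 i l\<bar> \<le> \<rho>"
        using \<rho> by (simp add: abs_le_square_iff [symmetric])
      then show ?thesis using True by (auto simp: mask_def C_def)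
    qed (auto simp: mask_def C_def)
    moreover have "(\<Sum>i<n. \<Sum>l<m. (mask X i l - G0 i l)\<^sup>2) = (\<Sum>i<n. \<Sum>l<m. (X i l - G0 i l)\<^sup>2)"
      by (intro sum.cong) (auto simp: mask_def)
    ultimately show ?thesis using X by (simp add: S_def)
  qed
  have e_mask: "e k (mask X) r l = e k X r l" "y (mask X) j l = y X j l" if "l < m" for k X r l j
    using that by (auto simp: e_def y_def mask_def intro!: sum.cong)
  have F_mask: "F k (mask X) = F k X" for k X
    by (simp add: F e_mask)
  have g_mask: "g k (mask X) v = g k X v" for k X v
    by (simp add: g_def e_mask)
  have e_add: "e (\<lambda>v. k v + t * d v) X r l = e k X r l + t * (\<Sum>j<c r. d (r, j) * y X j l)" for k t d X r l
  proof -
    have "err H L c (\<lambda>v. k v + t * d v) r i = err H L c k r i + t * (\<Sum>j<c r. d (r, j) * H j i)" for i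
      by (simp add: err_def algebra_simps sum.distrib sum_distrib_left)
    then have "e (\<lambda>v. k v + t * d v) X r l = e k X r l + t * (\<Sum>i<n. (\<Sum>j<c r. d (r, j) * H j i) * X i l)"
      by (simp add: e_def algebra_simps sum.distrib sum_distrib_left)
    also have "(\<Sum>i<n. (\<Sum>j<c r. d (r, j) * H j i) * X i l) = (\<Sum>j<c r. d (r, j) * y X j l)"
      unfolding y_def sum_distrib_right sum_distrib_left by (subst sum.swap) (simp add: mult.assoc)
    finally show ?thesis .
  qed
  have sumI: "(\<Sum>v\<in>I. q v) = (\<Sum>r<R. \<Sum>j<c r. q (r, j))" for q :: "nat \<times> nat \<Rightarrow> real"
    unfolding I_def by (subst sum.Sigma) auto
  have expand: "F (\<lambda>v. k v + t * d v) X = F k X + 2 * t * (\<Sum>v\<in>I. g k X v * d v) + t\<^sup>2 * h d X" for k d t X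
  proof -
    have "(\<Sum>v\<in>I. g k X v * d v) = (\<Sum>r<R. \<Sum>l<m. e k X r l * (\<Sum>j<c r. d (r, j) * y X j l))"
      unfolding sumI
    proof (rule sum.cong [OF refl])
      fix r
      have "(\<Sum>j<c r. g k X (r, j) * d (r, j)) = (\<Sum>j<c r. \<Sum>l<m. e k X r l * (d (r, j) * y X j l))"
        by (simp add: g_def sum_distrib_right sum_distrib_left mult_ac)
      then show "(\<Sum>j<c r. g k X (r, j) * d (r, j)) = (\<Sum>l<m. e k X r l * (\<Sum>j<c r. d (r, j) * y X j l))"
        by (simp add: sum_distrib_left sum.swap [of _ "{..<c r}"])
    qed
    moreover have "(\<Sum>r<R. \<Sum>l<m. (a r l + t * b r l)\<^sup>2) = (\<Sum>r<R. \<Sum>l<m. (a r l)\<^sup>2)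
        + 2 * t * (\<Sum>r<R. \<Sum>l<m. a r l * b r l) + t\<^sup>2 * (\<Sum>r<R. \<Sum>l<m. (b r l)\<^sup>2)" for a b
      by (simp add: power2_sum sum.distrib sum_distrib_left power_mult_distrib mult_ac)
    ultimately show ?thesis
      unfolding F e_add h_def by simp
  qed
  have gram_e: "(\<Sum>l<m. (e k X r l)\<^sup>2) = (\<Sum>i<n. \<Sum>i'<n. err H L c k r i * err H L c k r i' * (\<Sum>l<m. X i l * X i' l))" for k X r
    unfolding e_def power2_eq_square by (rule gram_bilinear)
  have gram_g: "g k X v = (\<Sum>i<n. \<Sum>i'<n. err H L c k (fst v) i * H (snd v) i' * (\<Sum>l<m. X i l * X i' l))" for k X v
    unfolding g_def e_def y_def by (rule gram_bilinear)
  \<comment> \<open>Keeps the nominal factor and spends the whole budget on independent noise of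
    equal size in all \<open>n\<close> coordinates, so that its covariance is positive definite
    whatever \<open>G0\<close> is.\<close>
  define s0 where "s0 = mask (\<lambda>i l. if l < n then G0 i l else if l = n + i then \<rho> / sqrt n else 0)"
  have s0_entry: "s0 i l = (if l < n then G0 i l else if l = n + i then \<rho> / sqrt n else 0)"
    if "i < n" "l < m" for i l
    using that by (simp add: s0_def mask_def)
  have s0: "s0 \<in> S"
    unfolding s0_def
  proof (rule mask)
    have "(\<Sum>l<m. ((if l < n then G0 i l else if l = n + i then \<rho> / sqrt n else 0) - G0 i l)\<^sup>2) = \<rho>\<^sup>2 / n" if "i < n" for i
    proof -
      have "(\<Sum>l<m. ((if l < n then G0 i l else if l = n + i then \<rho> / sqrt n else 0) - G0 i l)\<^sup>2)
        = (\<Sum>l<m. if l = n + i then \<rho>\<^sup>2 / n else 0)"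
        by (rule sum.cong) (auto simp: G0 power_divide)
      then show ?thesis using that by (simp add: m_def)
    qed
    then show "(\<Sum>i<n. \<Sum>l<m. ((if l < n then G0 i l else if l = n + i then \<rho> / sqrt n else 0) - G0 i l)\<^sup>2) \<le> \<rho>\<^sup>2"
      using n by simp
  qed
  have coercive: "\<rho>\<^sup>2 / n * (k v)\<^sup>2 \<le> F k s0" if vI: "v \<in> I" for k v
  proof -
    obtain r j where v: "v = (r, j)" "r < R" "j < c r"
      using vI by (auto simp: I_def)
    have l: "n + \<sigma> j < m" and sj: "\<sigma> j < n"
      using \<sigma>(1) [OF v(2,3)] by (simp_all add: m_def)
    have "(\<Sum>j'<c r. k (r, j') * H j' (\<sigma> j)) = (\<Sum>j'<c r. if j' = j then k (r, j') else 0)"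
      by (rule sum.cong) (auto simp: \<sigma>(2) [OF v(2,3)])
    then have 1: "err H L c k r (\<sigma> j) = k v"
      using v \<sigma>(3) [OF v(2,3)] by (simp add: err_def)
    \<comment> \<open>This column of \<open>s0\<close> excites only the noise coordinate
      \<open>\<sigma> j\<close>, where the error row reduces to the coefficient
      \<open>k (r, j)\<close>.\<close>
    have "e k s0 r (n + \<sigma> j) = (\<Sum>i<n. if i = \<sigma> j then err H L c k r i * (\<rho> / sqrt n) else 0)"
      unfolding e_def using l by (intro sum.cong) (auto simp: s0_entry)
    then have "e k s0 r (n + \<sigma> j) = k v * (\<rho> / sqrt n)"
      using sj 1 by simp
    then have "\<rho>\<^sup>2 / n * (k v)\<^sup>2 = (e k s0 r (n + \<sigma> j))\<^sup>2"
      by (simp add: power_mult_distrib power_divide)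
    also have "\<dots> \<le> (\<Sum>l<m. (e k s0 r l)\<^sup>2)"
      by (rule member_le_sum [of "n + \<sigma> j" "{..<m}" "\<lambda>l. (e k s0 r l)\<^sup>2"]) (use l in auto)
    also have "\<dots> \<le> F k s0"
      unfolding F by (rule member_le_sum [of r "{..<R}" "\<lambda>r. \<Sum>l<m. (e k s0 r l)\<^sup>2"])
        (use v in \<open>auto intro: sum_nonneg\<close>)
    finally show ?thesis .
  qed
  obtain k G where G: "G \<in> S" "\<And>X. X \<in> S \<Longrightarrow> F k X \<le> F k G" "\<And>v. v \<in> I \<Longrightarrow> g k G v = 0"
  proof (rule quadratic_minimax [where f = F and g = g and h = h and I = I and S = S and c = "\<rho>\<^sup>2 / n" and ?s0.0 = s0])
    show "finite I" by (simp add: I_def)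
    show "F (\<lambda>v. if v \<in> I then k v else 0) X = F k X" for k X
    proof -
      have "err H L c (\<lambda>v. if v \<in> I then k v else 0) r i = err H L c k r i" if "r < R" for r i
        using that by (auto simp: err_def I_def)
      then show ?thesis by (simp add: F e_def)
    qed
    have ke: "continuous_on UNIV (\<lambda>k :: nat \<times> nat \<Rightarrow> real. k v)" for v
      by (rule continuous_on_product_coordinates)
    show "continuous_on UNIV (\<lambda>k. F k X)" for X
      unfolding F e_def err_def by (intro continuous_intros ke)
    show "continuous_on S (F k)" for k
      unfolding F [abs_def] e_def by (intro continuous_intros)
    show "continuous_on S (\<lambda>X. g k X v)" for k v
      unfolding g_def e_def y_def by (intro continuous_intros)
    show "continuous_on S (h d)" for d
      unfolding h_def [abs_def] y_def by (intro continuous_intros)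
    show "0 < \<rho>\<^sup>2 / n" using \<rho> n by simp
    show "0 \<le> F k s0" for k
      unfolding F by (intro sum_nonneg) auto
    show "\<exists>u\<in>S. F k u = (1 - t) * F k X + t * F k X' \<and> (\<forall>v\<in>I. g k u v = (1 - t) * g k X v + t * g k X' v)"
      if X: "X \<in> S" "X' \<in> S" and t: "0 \<le> t" "t \<le> 1" for k X X' t
    proof -
      obtain U where U: "\<And>i l. l < n \<Longrightarrow> U i l = (1 - t) * X i l + t * X' i l"
        and gram: "\<And>i i'. i < n \<Longrightarrow> i' < n \<Longrightarrow> (\<Sum>l<m. U i l * U i' l)
          = (1 - t) * (\<Sum>l<m. X i l * X i' l) + t * (\<Sum>l<m. X' i l * X' i' l)"
        using gram_mix [OF t, of n X X'] unfolding m_def by blast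
      \<comment> \<open>The cross term involves only the first \<open>n\<close> columns because
        \<open>G0\<close> vanishes beyond them. The distance is therefore affine in exactly the data
        that \<open>gram_mix\<close> averages.\<close>
      have dist: "(\<Sum>l<m. (Y i l - G0 i l)\<^sup>2) = (\<Sum>l<m. Y i l * Y i l) - 2 * (\<Sum>l<n. Y i l * G0 i l) + (\<Sum>l<m. (G0 i l)\<^sup>2)" for Y i
      proof -
        have "(\<Sum>l<m. Y i l * G0 i l) = (\<Sum>l<n. Y i l * G0 i l)"
          using G0 by (intro sum.mono_neutral_right) (auto simp: m_def)
        moreover have "(\<Sum>l<m. (Y i l - G0 i l)\<^sup>2) = (\<Sum>l<m. Y i l * Y i l) - 2 * (\<Sum>l<m. Y i l * G0 i l) + (\<Sum>l<m. (G0 i l)\<^sup>2)"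
          by (simp add: power2_eq_square algebra_simps sum.distrib sum_subtractf sum_distrib_left)
        ultimately show ?thesis by simp
      qed
      have "(\<Sum>l<m. (U i l - G0 i l)\<^sup>2) = (1 - t) * (\<Sum>l<m. (X i l - G0 i l)\<^sup>2) + t * (\<Sum>l<m. (X' i l - G0 i l)\<^sup>2)" if "i < n" for i
      proof -
        have "(\<Sum>l<n. U i l * G0 i l) = (1 - t) * (\<Sum>l<n. X i l * G0 i l) + t * (\<Sum>l<n. X' i l * G0 i l)"
          by (simp add: U algebra_simps sum.distrib sum_subtractf sum_distrib_left)
        then show ?thesis
          unfolding dist gram [OF that that] by (simp add: algebra_simps)
      qed
      then have "(\<Sum>i<n. \<Sum>l<m. (U i l - G0 i l)\<^sup>2)
         = (1 - t) * (\<Sum>i<n. \<Sum>l<m. (X i l - G0 i l)\<^sup>2) + t * (\<Sum>i<n. \<Sum>l<m. (X' i l - G0 i l)\<^sup>2)"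
        by (simp add: sum.distrib sum_distrib_left)
      also have "\<dots> \<le> (1 - t) * \<rho>\<^sup>2 + t * \<rho>\<^sup>2"
        using X t by (intro add_mono mult_left_mono) (auto simp: S_def)
      also have "\<dots> = \<rho>\<^sup>2" by (simp add: algebra_simps)
      finally have "mask U \<in> S" by (rule mask)
      have q: "(\<Sum>i<n. \<Sum>i'<n. a i i' * (\<Sum>l<m. U i l * U i' l)) = (1 - t) * (\<Sum>i<n. \<Sum>i'<n. a i i' * (\<Sum>l<m. X i l * X i' l))
          + t * (\<Sum>i<n. \<Sum>i'<n. a i i' * (\<Sum>l<m. X' i l * X' i' l))" for a
      proof -
        have "(\<Sum>i<n. \<Sum>i'<n. a i i' * (\<Sum>l<m. U i l * U i' l)) = (\<Sum>i<n. \<Sum>i'<n. (1 - t) * (a i i' * (\<Sum>l<m. X i l * X i' l))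
            + t * (a i i' * (\<Sum>l<m. X' i l * X' i' l)))"
          by (intro sum.cong refl) (simp add: gram algebra_simps)
        then show ?thesis
          by (simp only: sum.distrib sum_distrib_left)
      qed
      have "F k U = (1 - t) * F k X + t * F k X'"
        unfolding F gram_e q by (simp only: sum.distrib sum_distrib_left)
      moreover have "g k U v = (1 - t) * g k X v + t * g k X' v" for v
        unfolding gram_g by (rule q)
      ultimately show ?thesis
        using \<open>mask U \<in> S\<close> by (intro bexI [of _ "mask U"]) (simp_all add: F_mask g_mask)
    qed
  qed (use S expand s0 coercive in auto)
  show ?thesis
  proof (rule that [of G k])
    show "(\<Sum>i<n. \<Sum>l<n + n. (G i l - G0 i l)\<^sup>2) \<le> \<rho>\<^sup>2"
      using G(1) by (simp add: S_def m_def)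
    show "F k X \<le> F k G" if "(\<Sum>i<n. \<Sum>l<n + n. (X i l - G0 i l)\<^sup>2) \<le> \<rho>\<^sup>2" for X
      using G(2) [OF mask [of X]] that by (simp add: F_mask m_def)
    show "(\<Sum>l<n + n. (\<Sum>i<n. err H L c k r i * G i l) * (\<Sum>i<n. H j i * G i l)) = 0"
      if "r < R" "j < c r" for r j
      using G(3) [of "(r, j)"] that by (simp add: I_def g_def e_def y_def m_def)
  qed
qed

text \<open>The symmetrisation \<open>z \<mapsto>\<close> flipped \<open>z\<close> turns the error \<open>u + e\<close> into \<open>u - e\<close>, and the two squares
  average to at least \<open>e\<^sup>2\<close>.\<close>
lemma nn_integral_orthogonal_error_le:
  assumes orth: "\<And>i. i < n \<Longrightarrow> (\<Sum>j<m. a j * b i j) = 0"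
    and [measurable]: "u \<in> borel_measurable (Rn n)"
  shows "(\<integral>\<^sup>+z. ennreal ((\<Sum>j<m. a j * z j)\<^sup>2) \<partial>std_normal_vec {..<m})
    \<le> (\<integral>\<^sup>+z. ennreal ((u (\<lambda>i\<in>{..<n}. \<Sum>j<m. b i j * z j) + (\<Sum>j<m. a j * z j))\<^sup>2) \<partial>std_normal_vec {..<m})"
proof -
  let ?e = "\<lambda>z. \<Sum>j<m. a j * z j" and ?y = "\<lambda>z. \<lambda>i\<in>{..<n}. \<Sum>j<m. b i j * z j"
  define I where "I s = (\<integral>\<^sup>+z. ennreal ((u (?y z) + s * ?e z)\<^sup>2) \<partial>std_normal_vec {..<m})" for s
  have [measurable]: "(\<lambda>z. u (?y z)) \<in> borel_measurable (std_normal_vec {..<m})"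
    by measurable
  have "I 1 = I (-1)"
    using nn_integral_std_normal_vec_flip [OF orth, where f = "\<lambda>e y. ennreal ((u y + e)\<^sup>2)"]
    by (simp add: I_def)
  have "2 * (\<integral>\<^sup>+z. ennreal ((?e z)\<^sup>2) \<partial>std_normal_vec {..<m}) = (\<integral>\<^sup>+z. 2 * ennreal ((?e z)\<^sup>2) \<partial>std_normal_vec {..<m})"
    by (rule nn_integral_cmult [symmetric]) measurable
  also have "\<dots> \<le> (\<integral>\<^sup>+z. ennreal ((u (?y z) + 1 * ?e z)\<^sup>2) + ennreal ((u (?y z) + (-1) * ?e z)\<^sup>2) \<partial>std_normal_vec {..<m})"
  proof (rule nn_integral_mono)
    fix z
    have "2 * (?e z)\<^sup>2 \<le> (u (?y z) + 1 * ?e z)\<^sup>2 + (u (?y z) + (-1) * ?e z)\<^sup>2"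
      by (simp add: power2_eq_square algebra_simps)
    then show "2 * ennreal ((?e z)\<^sup>2) \<le> ennreal ((u (?y z) + 1 * ?e z)\<^sup>2) + ennreal ((u (?y z) + (-1) * ?e z)\<^sup>2)"
      by (simp add: ennreal_leI flip: ennreal_plus ennreal_mult' ennreal_numeral)
  qed
  also have "\<dots> = I 1 + I (-1)"
    unfolding I_def by (rule nn_integral_add) measurable
  also have "\<dots> = 2 * I 1"
    using \<open>I 1 = I (-1)\<close> by (simp add: mult_2)
  finally show ?thesis
    by (simp add: I_def ennreal_mult_le_mult_iff)
qed

section \<open>Gaussian laws and membership in the Wasserstein ball\<close>

lemma gaussian_gauss_law:
  assumes "n \<le> m"
  shows "gaussian n (gauss_law n m G)"
proof -
  obtain L where L: "gauss_law n m G = gauss_law n n L"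
    using gauss_law_square [OF assms, of G] by metis
  show ?thesis
    unfolding gaussian_def gaussian_with_mean_def
    by (intro exI [of _ "\<lambda>_. 0"] exI [of _ L]) (simp add: L, simp add: gauss_law_def std_normal_vec_def)
qed

text \<open>Driving both laws by the same \<open>z\<close> is a coupling whose cost is the squared
  Frobenius distance of the factors.\<close>

lemma gauss_law_mem_wball:
  assumes ball: "(\<Sum>i<n. \<Sum>l<m. (G i l - G0 i l)\<^sup>2) \<le> \<rho>\<^sup>2"
  shows "gauss_law n m G \<in> wball n (gauss_law n m G0) \<rho>"
proof -
  define lin where "lin X z = (\<lambda>i\<in>{..<n}. \<Sum>l<m. X i l * z l)" for X :: "nat \<Rightarrow> nat \<Rightarrow> real" and z
  have lin [measurable]: "lin X \<in> measurable (std_normal_vec {..<m}) (Rn n)" for X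
    unfolding lin_def [abs_def] by measurable
  have l: "lin X z i = (\<Sum>l<m. X i l * z l)" if "i < n" for X z i
    using that by (simp add: lin_def)
  note [measurable] = measurable_Rn_component
  define \<mu> where "\<mu> = distr (std_normal_vec {..<m}) (Rn n \<Otimes>\<^sub>M Rn n) (\<lambda>z. (lin G z, lin G0 z))"
  have [measurable]: "(\<lambda>z. (lin G z, lin G0 z)) \<in> measurable (std_normal_vec {..<m}) (Rn n \<Otimes>\<^sub>M Rn n)"
    by measurable
  have "\<mu> \<in> couplings n (gauss_law n m G) (gauss_law n m G0)"
    unfolding couplings_def \<mu>_def
    by (auto simp: distr_distr comp_def gauss_law_def lin_def
        intro!: prob_space.prob_space_distr prob_space_std_normal_vec)
  then have "W2_sq n (gauss_law n m G) (gauss_law n m G0)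
     \<le> (\<integral>\<^sup>+w. ennreal (sqnorm n (\<lambda>i. fst w i - snd w i)) \<partial>\<mu>)"
    unfolding W2_sq_def by (rule INF_lower)
  also have "\<dots> = (\<integral>\<^sup>+z. ennreal (sqnorm n (\<lambda>i. lin G z i - lin G0 z i)) \<partial>std_normal_vec {..<m})"
    unfolding \<mu>_def by (subst nn_integral_distr) (auto simp: sqnorm_def)
  also have "\<dots> = (\<integral>\<^sup>+z. ennreal (\<Sum>i<n. (\<Sum>l<m. (G i l - G0 i l) * z l)\<^sup>2) \<partial>std_normal_vec {..<m})"
    by (simp add: sqnorm_def l left_diff_distrib sum_subtractf)
  also have "\<dots> \<le> ennreal (\<rho>\<^sup>2)"
    unfolding nn_integral_sum_lin_square using ball by (rule ennreal_leI)
  finally have "W2_sq n (gauss_law n m G) (gauss_law n m G0) \<le> ennreal (\<rho>\<^sup>2)" .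
  moreover have "finite_second_moment n (gauss_law n m G)"
  proof -
    have "(\<lambda>x. ennreal (sqnorm n x)) \<in> borel_measurable (Rn n)"
      unfolding sqnorm_def by measurable
    then have "(\<integral>\<^sup>+x. ennreal (sqnorm n x) \<partial>gauss_law n m G) = (\<integral>\<^sup>+z. ennreal (\<Sum>i<n. (\<Sum>l<m. G i l * z l)\<^sup>2) \<partial>std_normal_vec {..<m})"
      by (simp add: nn_integral_gauss_law sqnorm_def)
    then show ?thesis
      by (simp add: finite_second_moment_def nn_integral_sum_lin_square)
  qed
  ultimately show ?thesis
    by (simp add: wball_def prob_on_def prob_space_gauss_law sets_gauss_law)
qed

lemma gaussian_with_mean_zero_eq_gauss_law:
  assumes "gaussian_with_mean n (\<lambda>_. 0) P"
  obtains G0 where "P = gauss_law n (n + n) G0" "\<And>i l. n \<le> l \<Longrightarrow> G0 i l = 0"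
proof -
  obtain L :: "nat \<Rightarrow> nat \<Rightarrow> real" where "P = gauss_law n n L"
    using assms by (auto simp: gaussian_with_mean_def gauss_law_def std_normal_vec_def)
  also have "\<dots> = gauss_law n n (\<lambda>i l. if l < n then L i l else 0)"
    by (rule gauss_law_cong) simp
  also have "\<dots> = gauss_law n (n + n) (\<lambda>i l. if l < n then L i l else 0)"
    by (rule gauss_law_drop_columns [symmetric]) auto
  finally show ?thesis
    by (rule that) simp
qed

section \<open>The state-space model\<close>

definition unit_vec :: "nat \<Rightarrow> nat \<Rightarrow> real" where
  "unit_vec k i = (if i = k then 1 else 0)"

text \<open>Linearity and dependence on the first \<open>N\<close> coordinates in one formula, with
  coefficients given by values at unit vectors; the observation and signal matrices are read off
  from it.\<close>

definition linear_coords :: "nat \<Rightarrow> ((nat \<Rightarrow> real) \<Rightarrow> real) \<Rightarrow> bool" where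
  "linear_coords N f \<longleftrightarrow> (\<forall>x. f x = (\<Sum>n<N. f (unit_vec n) * x n))"

lemma linear_coords_component: "i < N \<Longrightarrow> linear_coords N (\<lambda>x. x i)"
  by (simp add: linear_coords_def unit_vec_def if_distrib [of "\<lambda>x. x * _"] cong: if_cong)

lemma linear_coords_add:
  assumes "linear_coords N f" "linear_coords N g"
  shows "linear_coords N (\<lambda>x. f x + g x)"
  unfolding linear_coords_def
proof
  fix x
  have "f x = (\<Sum>n<N. f (unit_vec n) * x n)" "g x = (\<Sum>n<N. g (unit_vec n) * x n)"
    using assms unfolding linear_coords_def by blast+
  then show "f x + g x = (\<Sum>n<N. (f (unit_vec n) + g (unit_vec n)) * x n)"
    by (simp only: distrib_right sum.distrib)
qed

lemma linear_coords_sum: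
  assumes "\<And>k. k \<in> K \<Longrightarrow> linear_coords N (f k)"
  shows "linear_coords N (\<lambda>x. \<Sum>k\<in>K. c k * f k x)"
  unfolding linear_coords_def
proof
  fix x
  have "c k * f k x = (\<Sum>n<N. c k * f k (unit_vec n) * x n)" if "k \<in> K" for k
  proof -
    have "f k x = (\<Sum>n<N. f k (unit_vec n) * x n)"
      using assms [OF that] unfolding linear_coords_def by blast
    then have "c k * f k x = c k * (\<Sum>n<N. f k (unit_vec n) * x n)"
      by (rule arg_cong)
    then show ?thesis
      by (simp only: sum_distrib_left mult.assoc)
  qed
  then have "(\<Sum>k\<in>K. c k * f k x) = (\<Sum>k\<in>K. \<Sum>n<N. c k * f k (unit_vec n) * x n)"
    by (rule sum.cong [OF refl])
  also have "\<dots> = (\<Sum>n<N. (\<Sum>k\<in>K. c k * f k (unit_vec n)) * x n)"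
    by (subst sum.swap) (simp only: sum_distrib_right)
  finally show "(\<Sum>k\<in>K. c k * f k x) = (\<Sum>n<N. (\<Sum>k\<in>K. c k * f k (unit_vec n)) * x n)" .
qed

lemma linear_coords_state:
  "i < dx \<Longrightarrow> dx + t * dw \<le> N \<Longrightarrow> linear_coords N (\<lambda>x. state dx dw A B x t i)"
proof (induction t arbitrary: i)
  case 0
  then show ?case by (simp add: linear_coords_component)
next
  case (Suc t)
  then show ?case
    unfolding state.simps mvec_def
    by (intro linear_coords_add linear_coords_sum linear_coords_component) auto
qed

lemma state_eq_0: "i < dx \<Longrightarrow> (\<And>n. n < dx + t * dw \<Longrightarrow> x n = 0) \<Longrightarrow> state dx dw A B x t i = 0"
  by (induction t arbitrary: i) (simp_all add: mvec_def)

lemma linear_coords_ystack: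
  assumes "j < T * dy" "N = xi_dim dx dw dy T"
  shows "linear_coords N (\<lambda>x. ystack dx dw dy T A B Cy x j)"
proof -
  have t: "j div dy < T"
    using assms by (simp add: less_mult_imp_div_less)
  then have "(j div dy) * dw \<le> (T - 1) * dw"
    by (intro mult_right_mono) auto
  then have 1: "dx + (j div dy) * dw \<le> N"
    unfolding assms(2) xi_dim_def by linarith
  have 2: "dx + (T - 1) * dw + j div dy * dy + j mod dy < N"
    using assms by (simp add: xi_dim_def)
  show ?thesis
    unfolding ystack_def Let_def mvec_def
    by (intro linear_coords_add linear_coords_sum linear_coords_state linear_coords_component 1 2) simp
qed

lemma linear_coords_signal:
  assumes "t < T" "N = xi_dim dx dw dy T"
  shows "linear_coords N (\<lambda>x. signal dx dw A B Cs x t k)"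
proof -
  have "t * dw \<le> (T - 1) * dw"
    using assms by (intro mult_right_mono) auto
  then have 1: "dx + t * dw \<le> N"
    unfolding assms(2) xi_dim_def by linarith
  show ?thesis
    unfolding signal_def mvec_def
    by (intro linear_coords_sum linear_coords_state 1) simp
qed

text \<open>Measurement noise is stored behind all process noise, beyond the coordinates below
  \<open>dx + t * dw\<close> that reach the state at time \<open>t\<close>.\<close>

lemma state_noise_unit:
  assumes "t < T" "i < dx"
  shows "state dx dw A B (unit_vec (dx + (T - 1) * dw + j)) t i = 0"
proof (rule state_eq_0 [OF assms(2)])
  fix n assume "n < dx + t * dw"
  moreover have "t * dw \<le> (T - 1) * dw"
    using assms by (intro mult_right_mono) auto
  ultimately have "n < dx + (T - 1) * dw + j"
    by linarith
  then show "unit_vec (dx + (T - 1) * dw + j) n = 0"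
    by (simp add: unit_vec_def)
qed

text \<open>Observations and measurement noises are flattened in the same way, so observation
  \<open>j'\<close> carries the noise at offset \<open>j'\<close>. This supplies the map
  \<open>\<sigma>\<close> of the linear game.\<close>

lemma ystack_noise_unit:
  assumes "j' < T * dy"
  shows "ystack dx dw dy T A B Cy (unit_vec (dx + (T - 1) * dw + j)) j' = (if j' = j then 1 else 0)"
proof -
  have "j' div dy < T"
    using assms by (simp add: less_mult_imp_div_less)
  then show ?thesis
    by (simp add: ystack_def Let_def mvec_def state_noise_unit del: One_nat_def)
      (simp add: unit_vec_def add.assoc)
qed

lemma signal_noise_unit: "t < T \<Longrightarrow> signal dx dw A B Cs (unit_vec (dx + (T - 1) * dw + j)) t k = 0"
  by (simp add: signal_def mvec_def state_noise_unit del: One_nat_def)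

lemma sum_flatten: "(\<Sum>t<T. \<Sum>k<d. f (t * d + k)) = (\<Sum>r<T * d. f r)" for f :: "nat \<Rightarrow> 'a::comm_monoid_add"
proof (induction T)
  case (Suc T)
  have "(\<Sum>r<T * d + k. f r) = (\<Sum>r<T * d. f r) + (\<Sum>l<k. f (T * d + l))" for k
    by (induction k) (simp_all add: add.assoc)
  with Suc show ?case by (simp add: add.commute)
qed simp

lemma saddle_point_imp_minimax:
  fixes J :: "'p \<Rightarrow> 'q \<Rightarrow> 'a::complete_lattice"
  assumes "p \<in> A" "q \<in> B" and "\<And>x y. x \<in> A \<Longrightarrow> y \<in> B \<Longrightarrow> J p y \<le> J p q \<and> J p q \<le> J x q"
  shows "(INF x\<in>A. SUP y\<in>B. J x y) = (SUP y\<in>B. INF x\<in>A. J x y)"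
proof (rule antisym)
  have "(INF x\<in>A. SUP y\<in>B. J x y) \<le> (SUP y\<in>B. J p y)"
    using assms(1) by (rule INF_lower)
  also have "\<dots> \<le> J p q"
    using assms by (intro SUP_least) auto
  also have "\<dots> \<le> (INF x\<in>A. J x q)"
    using assms by (intro INF_greatest) auto
  also have "\<dots> \<le> (SUP y\<in>B. INF x\<in>A. J x y)"
    using assms(2) by (rule SUP_upper)
  finally show "(INF x\<in>A. SUP y\<in>B. J x y) \<le> (SUP y\<in>B. INF x\<in>A. J x y)" .
  show "(SUP y\<in>B. INF x\<in>A. J x y) \<le> (INF x\<in>A. SUP y\<in>B. J x y)"
    by (intro SUP_least INF_greatest) (meson INF_lower SUP_upper order_trans)
qed

lemma sum_lin_image:
  "(\<Sum>i<n. a i * (\<lambda>i\<in>{..<n}. \<Sum>l<m. G i l * z l) i) = (\<Sum>l<m. (\<Sum>i<n. a i * G i l) * z l)"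
  for z :: "nat \<Rightarrow> real"
proof -
  have "(\<Sum>i<n. a i * (\<lambda>i\<in>{..<n}. \<Sum>l<m. G i l * z l) i) = (\<Sum>i<n. \<Sum>l<m. a i * G i l * z l)"
    by (intro sum.cong refl) (simp add: sum_distrib_left mult.assoc)
  also have "\<dots> = (\<Sum>l<m. (\<Sum>i<n. a i * G i l) * z l)"
    by (subst sum.swap) (simp only: sum_distrib_right)
  finally show ?thesis .
qed

theorem theorem3p1:
  fixes dx dw dy ds T :: nat
    and A B Cy Cs :: "nat \<Rightarrow> nat \<Rightarrow> real"
    and \<rho> :: real
    and P0 :: "(nat \<Rightarrow> real) measure"
  defines "N \<equiv> xi_dim dx dw dy T"
  defines "J \<equiv> mse dx dw dy ds T A B Cy Cs"
  defines "Est \<equiv> causal_estimators dy ds T"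
  defines "W \<equiv> wball N P0 \<rho>"
  assumes dims: "0 < dx" "0 < dw" "0 < dy" "0 < ds"
    and T_pos: "0 < T"
    and rho_pos: "0 < \<rho>"
    and det_y: "detectable dx dy A Cy"
    and det_s: "detectable dx ds A Cs"
    and ctrb: "controllable dx dw A B"
    and nominal: "gaussian_with_mean N (\<lambda>_. 0) P0"
  shows "(INF \<pi>\<in>Est. SUP P\<in>W. J \<pi> P) = (SUP P\<in>W. INF \<pi>\<in>Est. J \<pi> P)
         \<and> (\<exists>\<pi>s Ps. \<pi>s \<in> Est \<and> Ps \<in> W \<and> gaussian N Ps \<and> linear_estimator dy ds T \<pi>s
              \<and> (\<forall>\<pi>\<in>Est. \<forall>P\<in>W. J \<pi>s P \<le> J \<pi>s Ps \<and> J \<pi>s Ps \<le> J \<pi> Ps))"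
proof -
  have N: "0 < N"
    using dims by (simp add: N_def xi_dim_def)
  obtain G0 where P0: "P0 = gauss_law N (N + N) G0" and G0: "\<And>i l. N \<le> l \<Longrightarrow> G0 i l = 0"
    using gaussian_with_mean_zero_eq_gauss_law [OF nominal] by blast
  define R where "R = T * ds"
  \<comment> \<open>Number of scalar observations available to row \<open>r\<close>; the
    \<open>Suc\<close> is there because the estimate at time \<open>t\<close> may use
    \<open>y_t\<close> itself.\<close>
  define c where "c r = Suc (r div ds) * dy" for r
  define \<sigma> where "\<sigma> j = dx + (T - 1) * dw + j" for j
  define H where "H j n = ystack dx dw dy T A B Cy (unit_vec n) j" for j n
  define L where "L r n = signal dx dw A B Cs (unit_vec n) (r div ds) (r mod ds)" for r n
  have row: "r div ds < T" if "r < R" for r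
    using that by (simp add: R_def less_mult_imp_div_less)
  have obs: "j < T * dy" if "r < R" "j < c r" for r j
  proof -
    have "c r \<le> T * dy"
      unfolding c_def using row [OF that(1)] by (intro mult_right_mono) auto
    then show ?thesis using that by simp
  qed
  have flat: "t * ds + i < R" "(t * ds + i) div ds = t" "(t * ds + i) mod ds = i" "c (t * ds + i) = Suc t * dy"
    if "t < T" "i < ds" for t i
  proof -
    have "t * ds + i < Suc t * ds"
      using that by simp
    also have "\<dots> \<le> T * ds"
      using that by (intro mult_right_mono) auto
    finally show "t * ds + i < R" by (simp add: R_def)
  qed (use that in \<open>simp_all add: c_def\<close>)
  obtain k G where ball: "(\<Sum>i<N. \<Sum>l<N + N. (G i l - G0 i l)\<^sup>2) \<le> \<rho>\<^sup>2"
    and max: "\<And>X. (\<Sum>i<N. \<Sum>l<N + N. (X i l - G0 i l)\<^sup>2) \<le> \<rho>\<^sup>2 \<Longrightarrow>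
      (\<Sum>r<R. \<Sum>l<N + N. (\<Sum>i<N. err H L c k r i * X i l)\<^sup>2)
      \<le> (\<Sum>r<R. \<Sum>l<N + N. (\<Sum>i<N. err H L c k r i * G i l)\<^sup>2)"
    and orth: "\<And>r j. r < R \<Longrightarrow> j < c r \<Longrightarrow>
      (\<Sum>l<N + N. (\<Sum>i<N. err H L c k r i * G i l) * (\<Sum>i<N. H j i * G i l)) = 0"
  proof (rule linear_estimation_minimax [where n = N and \<rho> = \<rho> and ?G0.0 = G0 and R = R and c = c
        and \<sigma> = \<sigma> and H = H and L = L])
    show "\<sigma> j < N" if "r < R" "j < c r" for r j
      using obs [OF that] by (simp add: \<sigma>_def N_def xi_dim_def)
    show "H j' (\<sigma> j) = (if j' = j then 1 else 0)" if "r < R" "j < c r" "j' < c r" for r j j'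
      unfolding H_def \<sigma>_def using obs that by (intro ystack_noise_unit) blast
    show "L r (\<sigma> j) = 0" if "r < R" "j < c r" for r j
      unfolding L_def \<sigma>_def using row that by (intro signal_noise_unit) blast
  qed (use N rho_pos G0 in auto)
  define E where "E = err H L c k"
  define e where "e r l = (\<Sum>i<N. E r i * G i l)" for r l
  \<comment> \<open>Nothing is known about \<open>k\<close> outside the observations available to a
    row; zeros there make the matrix block lower triangular without affecting the estimates.\<close>
  define K where "K r j = (if j < c r then k (r, j) else 0)" for r j
  define \<pi>s where "\<pi>s t z i = (\<Sum>j<Suc t * dy. K (t * ds + i) j * z j)" for t i and z :: "nat \<Rightarrow> real"
  define Ps where "Ps = gauss_law N (N + N) G"
  define lin where "lin z = (\<lambda>i\<in>{..<N}. \<Sum>l<N + N. G i l * z l)" for z :: "nat \<Rightarrow> real"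
  define X where "X \<pi> \<xi> t i = \<pi> t (restrict (ystack dx dw dy T A B Cy \<xi>) {..<Suc t * dy}) i - signal dx dw A B Cs \<xi> t i"
    for \<pi> :: "nat \<Rightarrow> (nat \<Rightarrow> real) \<Rightarrow> nat \<Rightarrow> real" and \<xi> t i
  have y_lin: "ystack dx dw dy T A B Cy \<xi> j = (\<Sum>n<N. H j n * \<xi> n)" if "j < T * dy" for \<xi> j
    using linear_coords_ystack [OF that N_def [THEN meta_eq_to_obj_eq]]
    unfolding linear_coords_def H_def by blast
  have s_lin: "signal dx dw A B Cs \<xi> t i = (\<Sum>n<N. L (t * ds + i) n * \<xi> n)" if "t < T" "i < ds" for \<xi> t i
    using linear_coords_signal [OF that(1) N_def [THEN meta_eq_to_obj_eq]]
    unfolding linear_coords_def L_def flat(2,3) [OF that] by blast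
  have J: "J \<pi> P = (\<integral>\<^sup>+\<xi>. ennreal (\<Sum>t<T. \<Sum>i<ds. (X \<pi> \<xi> t i)\<^sup>2) \<partial>P)" for \<pi> P
    by (simp add: J_def mse_def sq_error_def X_def)
  have K_row: "K (t * ds + i) j = k (t * ds + i, j)" if "t < T" "i < ds" "j < Suc t * dy" for t i j
    using flat(4) [OF that(1,2)] that(3) by (simp only: K_def if_True)
  have obs_t: "j < T * dy" if "t < T" "j < Suc t * dy" for t j
    using obs [of "t * ds" j] flat [OF that(1) dims(4)] flat [OF that(1), of 0] that dims by simp
  have X_\<pi>s: "X \<pi>s \<xi> t i = (\<Sum>n<N. E (t * ds + i) n * \<xi> n)" if ti: "t < T" "i < ds" for \<xi> t i
  proof -
    have "\<pi>s t (restrict (ystack dx dw dy T A B Cy \<xi>) {..<Suc t * dy}) i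
       = (\<Sum>j<Suc t * dy. \<Sum>n<N. k (t * ds + i, j) * H j n * \<xi> n)"
      unfolding \<pi>s_def
    proof (rule sum.cong [OF refl])
      fix j assume "j \<in> {..<Suc t * dy}"
      then have j: "j < Suc t * dy" by simp
      then show "K (t * ds + i) j * restrict (ystack dx dw dy T A B Cy \<xi>) {..<Suc t * dy} j
        = (\<Sum>n<N. k (t * ds + i, j) * H j n * \<xi> n)"
        using K_row [OF ti j] y_lin [OF obs_t [OF ti(1) j]] by (simp add: sum_distrib_left mult.assoc)
    qed
    also have "\<dots> = (\<Sum>n<N. (\<Sum>j<Suc t * dy. k (t * ds + i, j) * H j n) * \<xi> n)"
      by (subst sum.swap) (simp only: sum_distrib_right)
    finally show ?thesis
      unfolding X_def s_lin [OF ti] E_def err_def flat(4) [OF ti]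
      by (simp only: left_diff_distrib sum_subtractf)
  qed
  have J_\<pi>s: "J \<pi>s P = (\<integral>\<^sup>+\<xi>. ennreal (\<Sum>r<R. (\<Sum>n<N. E r n * \<xi> n)\<^sup>2) \<partial>P)" for P
    unfolding J R_def sum_flatten [symmetric] by (simp add: X_\<pi>s)
  define v where "v = ennreal (\<Sum>r<R. \<Sum>l<N + N. (e r l)\<^sup>2)"
  have upper: "J \<pi>s P \<le> v" if "P \<in> W" for P
    unfolding J_\<pi>s v_def e_def E_def
    by (rule wasserstein_ball_second_moment_le [OF _ rho_pos ball max]) (use that N in \<open>simp_all add: W_def P0\<close>)
  have X_meas: "(\<lambda>\<xi>. X \<pi> \<xi> t i) \<in> borel_measurable (Rn N)" if "\<pi> \<in> Est" and ti: "t < T" "i < ds" for \<pi> t i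
  proof -
    note [measurable] = measurable_Rn_component
    have [measurable]: "(\<lambda>y. \<pi> t y i) \<in> borel_measurable (Rn (Suc t * dy))"
      using that by (simp add: Est_def causal_estimators_def)
    have y: "restrict (ystack dx dw dy T A B Cy \<xi>) {..<Suc t * dy} = (\<lambda>j\<in>{..<Suc t * dy}. \<Sum>n<N. H j n * \<xi> n)" for \<xi>
      using obs_t [OF ti(1)] by (intro restrict_ext y_lin) simp
    have [measurable]: "(\<lambda>\<xi>. \<lambda>j\<in>{..<Suc t * dy}. \<Sum>n<N. H j n * \<xi> n) \<in> measurable (Rn N) (Rn (Suc t * dy))"
      unfolding Rn_def [of "Suc t * dy"] by measurable
    show ?thesis
      unfolding X_def y s_lin [OF ti] by measurable
  qed
  have lower: "v \<le> J \<pi> Ps" if \<pi>: "\<pi> \<in> Est" for \<pi>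
  proof -
    let ?Z = "std_normal_vec {..<N + N}"
    have e_le: "ennreal (\<Sum>l<N + N. (e (t * ds + i) l)\<^sup>2) \<le> (\<integral>\<^sup>+z. ennreal ((X \<pi> (lin z) t i)\<^sup>2) \<partial>?Z)"
      if ti: "t < T" "i < ds" for t i
    proof -
      define b where "b j l = (\<Sum>n<N. H j n * G n l)" for j l
      \<comment> \<open>A competing estimator differs from \<open>\<pi>s\<close> by a function of
        the observations at hand. Each row has its own information set, so the orthogonality bound
        is applied row by row and summed afterwards.\<close>
      define u where "u y = \<pi> t y i - \<pi>s t y i" for y
      note [measurable] = measurable_Rn_component
      have [measurable]: "(\<lambda>y. \<pi> t y i) \<in> borel_measurable (Rn (Suc t * dy))"
        using \<pi> ti by (simp add: Est_def causal_estimators_def)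
      have u: "u \<in> borel_measurable (Rn (Suc t * dy))"
        unfolding u_def [abs_def] \<pi>s_def by measurable
      have y: "restrict (ystack dx dw dy T A B Cy (lin z)) {..<Suc t * dy} = (\<lambda>j\<in>{..<Suc t * dy}. \<Sum>l<N + N. b j l * z l)" for z
        unfolding b_def using obs_t [OF ti(1)]
        by (intro restrict_ext) (simp only: y_lin lin_def sum_lin_image lessThan_iff)
      have "X \<pi> (lin z) t i = u (restrict (ystack dx dw dy T A B Cy (lin z)) {..<Suc t * dy}) + X \<pi>s (lin z) t i" for z
        unfolding X_def u_def by simp
      moreover have "X \<pi>s (lin z) t i = (\<Sum>l<N + N. e (t * ds + i) l * z l)" for z
        unfolding X_\<pi>s [OF ti] lin_def sum_lin_image e_def ..
      ultimately have X: "X \<pi> (lin z) t i = u (\<lambda>j\<in>{..<Suc t * dy}. \<Sum>l<N + N. b j l * z l) + (\<Sum>l<N + N. e (t * ds + i) l * z l)" for z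
        unfolding y by simp
      have "(\<Sum>l<N + N. e (t * ds + i) l * b j l) = 0" if "j < Suc t * dy" for j
        unfolding e_def b_def E_def using orth [OF flat(1) [OF ti], of j] that unfolding flat(4) [OF ti] .
      from nn_integral_orthogonal_error_le [OF this u] show ?thesis
        unfolding X nn_integral_std_normal_vec_lin_square .
    qed
    have X_lin [measurable]: "(\<lambda>z. X \<pi> (lin z) t i) \<in> borel_measurable ?Z" if "t < T" "i < ds" for t i
      unfolding lin_def by (rule measurable_compose [OF measurable_lin X_meas [OF \<pi> that]])
    have "v = (\<Sum>t<T. \<Sum>i<ds. ennreal (\<Sum>l<N + N. (e (t * ds + i) l)\<^sup>2))"
      unfolding v_def R_def sum_flatten [symmetric] by (simp add: sum_ennreal sum_nonneg)
    also have "\<dots> \<le> (\<Sum>t<T. \<Sum>i<ds. \<integral>\<^sup>+z. ennreal ((X \<pi> (lin z) t i)\<^sup>2) \<partial>?Z)"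
      by (intro sum_mono e_le) auto
    also have "\<dots> = (\<Sum>t<T. \<integral>\<^sup>+z. (\<Sum>i<ds. ennreal ((X \<pi> (lin z) t i)\<^sup>2)) \<partial>?Z)"
      by (intro sum.cong refl nn_integral_sum [symmetric]) auto
    also have "\<dots> = (\<integral>\<^sup>+z. (\<Sum>t<T. \<Sum>i<ds. ennreal ((X \<pi> (lin z) t i)\<^sup>2)) \<partial>?Z)"
      by (intro nn_integral_sum [symmetric]) (auto intro!: borel_measurable_sum)
    also have "\<dots> = (\<integral>\<^sup>+z. ennreal (\<Sum>t<T. \<Sum>i<ds. (X \<pi> (lin z) t i)\<^sup>2) \<partial>?Z)"
      by (simp add: sum_ennreal sum_nonneg)
    also have "\<dots> = J \<pi> Ps"
      unfolding J Ps_def lin_def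
      by (rule nn_integral_gauss_law [symmetric])
        (intro measurable_compose [OF _ measurable_ennreal] borel_measurable_sum borel_measurable_power X_meas [OF \<pi>], auto)
    finally show ?thesis .
  qed
  have Ps: "Ps \<in> W" "gaussian N Ps"
    unfolding Ps_def W_def P0 using gauss_law_mem_wball [OF ball] gaussian_gauss_law by auto
  have \<pi>s_meas: "\<pi>s \<in> Est"
    unfolding Est_def causal_estimators_def \<pi>s_def
    by (auto intro!: borel_measurable_sum borel_measurable_times measurable_Rn_component)
  have "block_lower_tri ds dy T K"
    unfolding block_lower_tri_def
  proof (intro allI impI)
    fix t \<tau> i l assume *: "t < T" "\<tau> < T" "i < ds" "l < dy" "t < \<tau>"
    have "Suc t * dy \<le> \<tau> * dy"
      using * by (intro mult_right_mono) auto
    then show "K (t * ds + i) (\<tau> * dy + l) = 0"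
      using flat(4) [OF *(1,3)] by (simp add: K_def)
  qed
  then have lin_\<pi>s: "linear_estimator dy ds T \<pi>s"
    unfolding linear_estimator_def \<pi>s_def by blast
  \<comment> \<open>Both bounds applied to the pair \<open>\<pi>s\<close>, \<open>Ps\<close> itself
    give \<open>J \<pi>s Ps = v\<close>, the value of the game.\<close>
  have saddle: "J \<pi>s P \<le> J \<pi>s Ps \<and> J \<pi>s Ps \<le> J \<pi> Ps" if "\<pi> \<in> Est" "P \<in> W" for \<pi> P
    using upper [OF that(2)] upper [OF Ps(1)] lower [OF that(1)] lower [OF \<pi>s_meas] order_trans by blast
  then show ?thesis
    using saddle_point_imp_minimax [of \<pi>s Est Ps W J] \<pi>s_meas Ps lin_\<pi>s by blast
qed

end
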